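(* Let $n\ge 3$, and let $K$ be a finite $(n-1)$-dimensional oriented strongly connected pseudo-manifold. For each edge $\{u,v\}$ of $K$ let $\ell_{uv}$ be a formal variable, and let $\mathbb{Z}[\ell]$ be the polynomial ring over $\mathbb{Z}$ in these variables. Then there exist an integer $N\ge 1$ and polynomials $b_1,\ldots,b_N\in\mathbb{Z}[\ell]$ such that for every simplicial polyhedron $P\colon |K|\to\mathbb{R}^n$ of combinatorial type $K$, with $W=2^{[\frac n2]}\,n!\,V(P)$, $$W^{2N}+b_1(\ell)W^{2N-2}+\dots+b_N(\ell)=0,$$ where the polynomials $b_i$ are evaluated at the squares of the edge lengths of $P$, i.e. at $\ell_{uv}=\|P(u)-P(v)\|^2$ for $\{u,v\}\in K$.
   Context: An abstract simplicial complex on a vertex set $\mathcal V$ is a set $K$ of subsets of $\mathcal V$ with $\emptyset\in K$ and closed under taking subsets; $\dim\sigma=|\sigma|-1$; $|K|$ is the geometric realization. $K$ is a $k$-dimensional pseudo-manifold if every simplex of $K$ is contained in a $k$-simplex and every $(k-1)$-simplex is contained in exactly two $k$-simplices. It is strongly connected if any two $k$-simplices can be joined by a sequence of $k$-simplices in which consecutive ones share a common $(k-1)$-face. It is oriented if its $k$-simplices are endowed with consistent orientations (the two $k$-simplices containing a given $(k-1)$-simplex induce opposite orientations on it). A simplicial polyhedron of combinatorial type $K$ (where $\dim K=n-1$) is a map $P\colon|K|\to\mathbb{R}^n$ whose restriction to every simplex is linear (affine); it need not be injective and may be degenerate on simplices. The generalized oriented volume is $$V(P)=\sum_{i=1}^q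 V\bigl(O,P(v_1^{(i)}),\ldots,P(v_n^{(i)})\bigr),$$ where $\{v_1^{(i)},\ldots,v_n^{(i)}\}$, $i=1,\ldots,q$, are all distinct positively oriented $(n-1)$-simplices of $K$ (vertices listed in an order giving the orientation), $O\in\mathbb{R}^n$ is an arbitrary point (the result does not depend on it), and $V(p_0,\ldots,p_n)=\frac1{n!}\det(p_1-p_0,\ldots,p_n-p_0)$ is the oriented volume of the simplex with vertices $p_0,\dots,p_n$. $[\cdot]$ denotes integer part. *)

theory Defs
  imports
    Complex_Main
    "HOL-Library.Poly_Mapping"
    "HOL-Combinatorics.Permutations"
    "Jordan_Normal_Form.Determinant"
begin

section \<open>Simplicial complexes and pseudo-manifolds\<close>

text \<open>Simplices are required to be finite explicitly, since \<open>card\<close> is \<open>0\<close> on infinite sets.\<close>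

definition simplicial_complex :: "'v set set \<Rightarrow> bool" where
  "simplicial_complex K \<longleftrightarrow>
     {} \<in> K \<and> (\<forall>\<sigma>\<in>K. finite \<sigma>) \<and> (\<forall>\<sigma>\<in>K. \<forall>\<tau>. \<tau> \<subseteq> \<sigma> \<longrightarrow> \<tau> \<in> K)"

definition simplices :: "nat \<Rightarrow> 'v set set \<Rightarrow> 'v set set" where
  "simplices k K = {\<sigma> \<in> K. card \<sigma> = k + 1}"

text \<open>A \<open>(k - 1)\<close>-simplex is a member of \<open>K\<close> of cardinality \<open>k\<close>; stating it this way avoids
  truncated subtraction for \<open>k = 0\<close>.\<close>

definition pseudo_manifold :: "nat \<Rightarrow> 'v set set \<Rightarrow> bool" where
  "pseudo_manifold k K \<longleftrightarrow>
     simplicial_complex K \<and>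
     (\<forall>\<sigma>\<in>K. \<exists>\<tau>\<in>simplices k K. \<sigma> \<subseteq> \<tau>) \<and>
     (\<forall>\<rho>\<in>K. card \<rho> = k \<longrightarrow> card {\<sigma> \<in> simplices k K. \<rho> \<subseteq> \<sigma>} = 2)"

definition adjacent_simplices :: "nat \<Rightarrow> 'v set set \<Rightarrow> ('v set \<times> 'v set) set" where
  "adjacent_simplices k K =
     {(\<sigma>, \<tau>). \<sigma> \<in> simplices k K \<and> \<tau> \<in> simplices k K \<and>
        (\<exists>\<rho>\<in>K. card \<rho> = k \<and> \<rho> \<subseteq> \<sigma> \<and> \<rho> \<subseteq> \<tau>)}"

definition strongly_connected :: "nat \<Rightarrow> 'v set set \<Rightarrow> bool" where
  "strongly_connected k K \<longleftrightarrow>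
     (\<forall>\<sigma>\<in>simplices k K. \<forall>\<tau>\<in>simplices k K. (\<sigma>, \<tau>) \<in> (adjacent_simplices k K)\<^sup>*)"

definition edges :: "'v set set \<Rightarrow> 'v set set" where
  "edges K = simplices 1 K"


section \<open>Orientations\<close>

text \<open>An orientation of a simplex is a class of orderings of its vertices modulo even
  permutations. It is represented as the set of the positive orderings.\<close>

definition simplex_orientation :: "'v set \<Rightarrow> 'v list set \<Rightarrow> bool" where
  "simplex_orientation \<sigma> A \<longleftrightarrow>
     (\<exists>vs. distinct vs \<and> set vs = \<sigma> \<and>
        A = {permute_list p vs | p. p permutes {..<length vs} \<and> evenperm p})"

text \<open>The orientation \<open>[u, v\<^sub>1, \<dots>, v\<^sub>k]\<close> of a simplex induces the orientation
  \<open>[v\<^sub>1, \<dots>, v\<^sub>k]\<close> on the facet opposite to \<open>u\<close>. For \<open>k \<ge> 2\<close> a facet has exactly two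
  orientations, and they are opposite iff they are disjoint as sets of orderings.\<close>

definition induced_orientation :: "'v list set \<Rightarrow> 'v set \<Rightarrow> 'v list set" where
  "induced_orientation A \<rho> = {vs. set vs = \<rho> \<and> (\<exists>u. u \<notin> \<rho> \<and> u # vs \<in> A)}"

definition consistent_orientation ::
  "nat \<Rightarrow> 'v set set \<Rightarrow> ('v set \<Rightarrow> 'v list set) \<Rightarrow> bool" where
  "consistent_orientation k K ori \<longleftrightarrow>
     (\<forall>\<sigma>\<in>simplices k K. simplex_orientation \<sigma> (ori \<sigma>)) \<and>
     (\<forall>\<sigma>\<in>simplices k K. \<forall>\<tau>\<in>simplices k K. \<forall>\<rho>\<in>K.
        \<sigma> \<noteq> \<tau> \<and> card \<rho> = k \<and> \<rho> \<subseteq> \<sigma> \<and> \<rho> \<subseteq> \<tau> \<longrightarrow>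
        induced_orientation (ori \<sigma>) \<rho> \<inter> induced_orientation (ori \<tau>) \<rho> = {})"


section \<open>Simplicial polyhedra and the generalized oriented volume\<close>

text \<open>Points of the geometric realization are given by their barycentric coordinates.\<close>

definition geometric_realization :: "'v set set \<Rightarrow> ('v \<Rightarrow> real) set" where
  "geometric_realization K =
     {x. {v. x v \<noteq> 0} \<in> K \<and> (\<forall>v. x v \<ge> 0) \<and> (\<Sum>v | x v \<noteq> 0. x v) = 1}"

definition realized_simplex :: "'v set set \<Rightarrow> 'v set \<Rightarrow> ('v \<Rightarrow> real) set" where
  "realized_simplex K \<sigma> = {x \<in> geometric_realization K. {v. x v \<noteq> 0} \<subseteq> \<sigma>}"

definition vertex_point :: "'v \<Rightarrow> 'v \<Rightarrow> real" where
  "vertex_point v = (\<lambda>w. if w = v then 1 else 0)"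

text \<open>\<open>\<real>\<^sup>n\<close> is \<open>carrier_vec n :: real vec set\<close>.\<close>

definition simplicial_polyhedron ::
  "nat \<Rightarrow> 'v set set \<Rightarrow> (('v \<Rightarrow> real) \<Rightarrow> real vec) \<Rightarrow> bool" where
  "simplicial_polyhedron n K P \<longleftrightarrow>
     (\<forall>x\<in>geometric_realization K. P x \<in> carrier_vec n) \<and>
     (\<forall>\<sigma>\<in>K. \<forall>x\<in>realized_simplex K \<sigma>. \<forall>y\<in>realized_simplex K \<sigma>. \<forall>t\<in>{0..1}.
        P (\<lambda>v. (1 - t) * x v + t * y v) = (1 - t) \<cdot>\<^sub>v P x + t \<cdot>\<^sub>v P y)"

definition oriented_simplex_volume :: "nat \<Rightarrow> real vec \<Rightarrow> real vec list \<Rightarrow> real" where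
  "oriented_simplex_volume n p0 ps = det (mat_of_cols n (map (\<lambda>p. p - p0) ps)) / fact n"

text \<open>The value does not depend on the positive ordering chosen for each \<open>\<sigma>\<close>. The point \<open>Q\<close>
  is the base point (usually written \<open>O\<close>).\<close>

definition generalized_volume ::
  "nat \<Rightarrow> 'v set set \<Rightarrow> ('v set \<Rightarrow> 'v list set) \<Rightarrow> real vec \<Rightarrow> (('v \<Rightarrow> real) \<Rightarrow> real vec) \<Rightarrow> real" where
  "generalized_volume n K ori Q P =
     (\<Sum>\<sigma>\<in>simplices (n - 1) K.
        oriented_simplex_volume n Q (map (\<lambda>v. P (vertex_point v)) (SOME vs. vs \<in> ori \<sigma>)))"


section \<open>Integer polynomials in the edge variables\<close>

text \<open>A polynomial maps monomials to coefficients, a monomial maps variables to exponents. The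
  ring structure is the convolution product of \<open>Poly_Mapping\<close>.\<close>

type_synonym 'x int_mpoly = "('x \<Rightarrow>\<^sub>0 nat) \<Rightarrow>\<^sub>0 int"

definition polys_over :: "'x set \<Rightarrow> 'x int_mpoly set" where
  "polys_over X = {p. \<forall>m\<in>Poly_Mapping.keys p. Poly_Mapping.keys m \<subseteq> X}"

definition eval_mpoly :: "('x \<Rightarrow> 'r::comm_ring_1) \<Rightarrow> 'x int_mpoly \<Rightarrow> 'r" where
  "eval_mpoly a p =
     (\<Sum>m\<in>Poly_Mapping.keys p. of_int (Poly_Mapping.lookup p m) *
        (\<Prod>x\<in>Poly_Mapping.keys m. a x ^ Poly_Mapping.lookup m x))"

text \<open>The variable of the edge \<open>{u, v}\<close> is the set \<open>{u, v}\<close> itself; it takes the value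
  \<open>\<parallel>P u - P v\<parallel>\<^sup>2\<close>, which is symmetric in \<open>u\<close> and \<open>v\<close>.\<close>

definition squared_edge_lengths ::
  "'v set set \<Rightarrow> (('v \<Rightarrow> real) \<Rightarrow> real vec) \<Rightarrow> ('v set \<Rightarrow> real) \<Rightarrow> bool" where
  "squared_edge_lengths K P l \<longleftrightarrow>
     (\<forall>u v. {u, v} \<in> edges K \<longrightarrow>
        l {u, v} = (P (vertex_point u) - P (vertex_point v)) \<bullet>
                   (P (vertex_point u) - P (vertex_point v)))"

end

theory Submission
  imports Defs "HOL-Computational_Algebra.Polynomial" "HOL-Analysis.Continuum_Not_Denumerable"
begin

text \<open>
Let \<open>W\<close> be the normalised volume and \<open>R\<close> the subring of the reals generated by the squared edge
lengths of one polyhedron. The relation says that \<open>W\<^sup>2\<close> is integral over \<open>R\<close>, with a shape of relation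
that serves all polyhedra at once.

Integrality is tested on valuation rings: if \<open>W\<^sup>2\<close> is not integral over \<open>R\<close>, some valuation ring \<open>A\<close> of
the field of reals contains \<open>R\<close> but not \<open>W\<^sup>2\<close> (\<open>exists_valuation_ring\<close>). So fix \<open>A\<close> and call a squared
distance \<open>l u v\<close> finite if it lies in \<open>A\<close>. All edges of \<open>K\<close> are finite, hence the fundamental cycle of \<open>K\<close>
lives in the flag complex \<open>X\<close> of the graph of finite distances on the vertices. If it bounds in \<open>X\<close>, then
its volume is an integer combination of volumes of \<open>n\<close>-simplices with finite edges. By the Gram determinant
\<open>2\<^sup>n det\<^sup>2\<close>, and by its evenness for odd \<open>n\<close>, each of these becomes an element of \<open>A\<close> after multiplication by
\<open>2 ^ (n div 2) * fact n\<close> (\<open>simplex_volume_integral\<close>). So \<open>W\<close> lies in \<open>A\<close>, a contradiction.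

It remains to see that \<open>(n - 1)\<close>-cycles of \<open>X\<close> bound. Start from the full simplex on the vertices and delete
the infinite edges one by one, in order of decreasing absolute value. Deleting the edge \<open>uv\<close> can create a
nonbounding \<open>(n - 1)\<close>-cycle only if the link of \<open>uv\<close> carries a nonbounding cycle of dimension one less; iterating,
an obstruction produces \<open>n\<close> disjoint infinite pairs such that the distances between points of different pairs
were deleted later or not at all (\<open>cycle_bounds_unless_cross_polytope\<close>). The matrix of squared
distances of these \<open>2 n\<close> points is dominated by the entries of the pairs, hence nonsingular
(\<open>matching_dominant_nonsingular\<close>). But \<open>l u v\<close> is the value of a bilinear form in
\<open>n + 2\<close> variables on the lifts \<open>(1, x, \<bar>x\<bar>\<^sup>2)\<close>, so its matrices have rank at most \<open>n + 2\<close>, and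
\<open>n + 2 < 2 n\<close> because \<open>n \<ge> 3\<close>. Edges of equal absolute value need care: among them, those with the smaller least
endpoint are deleted first, and this makes the tied part of the matrix block triangular.

To get one relation for all polyhedra, note that there are only countably many candidate relations, each of
them a polynomial in the coordinates of the points. If none vanished identically, some point would make all of
them nonzero (\<open>common_nonzero\<close>), although every point satisfies one.
\<close>

section \<open>Subrings, integrality and valuation rings\<close>

definition subring :: "'a::comm_ring_1 set \<Rightarrow> bool" where
  "subring A \<longleftrightarrow> 1 \<in> A \<and> (\<forall>x\<in>A. \<forall>y\<in>A. x - y \<in> A \<and> x * y \<in> A)"

lemma subring_1: "subring A \<Longrightarrow> 1 \<in> A"
  and subring_diff: "subring A \<Longrightarrow> x \<in> A \<Longrightarrow> y \<in> A \<Longrightarrow> x - y \<in> A"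
  and subring_mult: "subring A \<Longrightarrow> x \<in> A \<Longrightarrow> y \<in> A \<Longrightarrow> x * y \<in> A"
  unfolding subring_def by auto

lemma subring_0: "subring A \<Longrightarrow> 0 \<in> A"
  using subring_diff[of A 1 1] subring_1 by auto

lemma subring_uminus: "subring A \<Longrightarrow> x \<in> A \<Longrightarrow> - x \<in> A"
  using subring_diff[of A 0 x] subring_0 by auto

lemma subring_add: "subring A \<Longrightarrow> x \<in> A \<Longrightarrow> y \<in> A \<Longrightarrow> x + y \<in> A"
  using subring_diff[of A x "- y"] subring_uminus by auto

lemma subring_power: "subring A \<Longrightarrow> x \<in> A \<Longrightarrow> x ^ k \<in> A"
  by (induction k) (auto intro: subring_1 subring_mult)

lemma subring_sum: "subring A \<Longrightarrow> (\<And>i. i \<in> I \<Longrightarrow> f i \<in> A) \<Longrightarrow> sum f I \<in> A"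
  by (induction I rule: infinite_finite_induct) (auto intro: subring_0 subring_add)

lemma subring_prod: "subring A \<Longrightarrow> (\<And>i. i \<in> I \<Longrightarrow> f i \<in> A) \<Longrightarrow> prod f I \<in> A"
  by (induction I rule: infinite_finite_induct) (auto intro: subring_1 subring_mult)

lemma subring_of_nat: "subring A \<Longrightarrow> of_nat k \<in> A"
  by (induction k) (auto intro: subring_0 subring_1 subring_add)

lemma subring_of_int: "subring A \<Longrightarrow> of_int k \<in> A"
  by (cases k rule: int_cases2) (auto intro: subring_of_nat subring_uminus)

definition polys_in :: "'a::comm_ring_1 set \<Rightarrow> 'a poly set" where
  "polys_in A = {p. \<forall>i. coeff p i \<in> A}"

definition adjoin :: "'a::comm_ring_1 set \<Rightarrow> 'a \<Rightarrow> 'a set" where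
  "adjoin A x = (\<lambda>p. poly p x) ` polys_in A"

lemma subring_adjoin:
  assumes A: "subring A"
  shows "subring (adjoin A x)"
proof -
  have "1 \<in> polys_in A"
    using A by (auto simp: polys_in_def coeff_1 intro: subring_0 subring_1)
  moreover have "p - q \<in> polys_in A" "p * q \<in> polys_in A" if "p \<in> polys_in A" "q \<in> polys_in A" for p q
    using that A by (auto simp: polys_in_def coeff_mult intro!: subring_diff subring_sum subring_mult)
  ultimately show ?thesis
    unfolding subring_def adjoin_def by (force simp flip: poly_diff poly_mult intro: image_eqI[where x=1])
qed

lemma subset_adjoin:
  assumes A: "subring A"
  shows "A \<subseteq> adjoin A x"
proof
  fix a assume "a \<in> A"
  hence "[:a:] \<in> polys_in A"
    using subring_0[OF A] by (auto simp: polys_in_def coeff_pCons split: nat.split)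
  thus "a \<in> adjoin A x" unfolding adjoin_def by force
qed

lemma in_adjoin:
  assumes A: "subring A"
  shows "x \<in> adjoin A x"
proof -
  have "[:0,1:] \<in> polys_in A"
    using subring_0[OF A] subring_1[OF A] by (auto simp: polys_in_def coeff_pCons split: nat.split)
  thus ?thesis unfolding adjoin_def by force
qed

lemma adjoinE:
  assumes "w \<in> adjoin A x"
  obtains a m where "\<forall>i. a i \<in> A" "w = (\<Sum>i\<le>m. a i * x ^ i)"
proof -
  from assms obtain p where p: "p \<in> polys_in A" "w = poly p x" by (auto simp: adjoin_def)
  have "w = (\<Sum>i\<le>degree p. coeff p i * x ^ i)" using p by (simp add: poly_altdef)
  thus ?thesis using that[of "coeff p" "degree p"] p by (auto simp: polys_in_def)
qed

definition valuation_ring :: "'a::field set \<Rightarrow> bool" where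
  "valuation_ring A \<longleftrightarrow> subring A \<and> (\<forall>x. x \<in> A \<or> inverse x \<in> A)"

text \<open>If \<open>w\<close> is written as a polynomial in \<open>x\<close> and, with no larger degree, as a polynomial in \<open>1 / x\<close>, then the
second expression, divided by \<open>w\<close>, writes \<open>1\<close> by negative powers of \<open>x\<close> only; the constant term is removed
because \<open>1 - u b\<close> is a unit. Multiplying the leading monomial of the first expression by this lowers its degree.\<close>

lemma shorten_expression:
  fixes x w :: "'a::field"
  assumes A: "subring A" and x0: "x \<noteq> 0" and wu: "w * u = 1" and uA: "u \<in> A"
    and units: "\<And>b. b \<in> A \<Longrightarrow> inverse (1 - u * b) \<in> A \<and> 1 - u * b \<noteq> 0"
    and a: "\<forall>i. a i \<in> A" and wa: "w = (\<Sum>i\<le>Suc m. a i * x ^ i)"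
    and b: "\<forall>i. b i \<in> A" and wb: "w = (\<Sum>i\<le>k. b i * inverse x ^ i)" and km: "k \<le> Suc m"
  shows "\<exists>a'. (\<forall>i. a' i \<in> A) \<and> w = (\<Sum>i\<le>m. a' i * x ^ i)"
proof -
  define c where "c = inverse (1 - u * b 0)"
  have c: "c \<in> A" "c * (1 - u * b 0) = 1" using units[of "b 0"] b by (auto simp: c_def)
  have "w = b 0 + (\<Sum>i\<in>{1..k}. b i * inverse x ^ i)"
    unfolding wb using sum.atMost_shift[of "\<lambda>i. b i * inverse x ^ i" k]
    by (simp add: sum.atLeast1_atMost_eq lessThan_Suc_atMost)
  hence "u * w = u * b 0 + u * (\<Sum>i\<in>{1..k}. b i * inverse x ^ i)" by (simp add: algebra_simps)
  hence "1 - u * b 0 = u * (\<Sum>i\<in>{1..k}. b i * inverse x ^ i)" using wu by (simp add: algebra_simps)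
  hence one: "1 = c * u * (\<Sum>i\<in>{1..k}. b i * inverse x ^ i)" using c(2) by (simp add: mult.assoc)
  define d where "d = (\<lambda>i. c * u * b i * a (Suc m))"
  define e where "e = (\<lambda>j. if j \<in> {Suc m - k..m} then d (Suc m - j) else 0)"
  have dA: "d i \<in> A" for i using c uA a b A by (auto simp: d_def intro!: subring_mult)
  have "a (Suc m) * x ^ Suc m = 1 * (a (Suc m) * x ^ Suc m)" by simp
  also have "\<dots> = c * u * (\<Sum>i\<in>{1..k}. b i * inverse x ^ i) * (a (Suc m) * x ^ Suc m)"
    using one by metis
  also have "\<dots> = (\<Sum>i\<in>{1..k}. d i * (inverse x ^ i * x ^ Suc m))"
    by (simp add: d_def sum_distrib_left sum_distrib_right mult_ac)
  also have "\<dots> = (\<Sum>i\<in>{1..k}. d i * x ^ (Suc m - i))"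
    by (rule sum.cong) (use km x0 in \<open>auto simp: power_diff field_simps simp del: power_Suc\<close>)
  also have "\<dots> = (\<Sum>j\<in>{Suc m - k..m}. d (Suc m - j) * x ^ j)"
    by (rule sum.reindex_bij_witness[of _ "\<lambda>j. Suc m - j" "\<lambda>i. Suc m - i"]) (use km in auto)
  also have "\<dots> = (\<Sum>j\<in>{Suc m - k..m}. e j * x ^ j)" by (simp add: e_def)
  also have "\<dots> = (\<Sum>j\<le>m. e j * x ^ j)"
    by (rule sum.mono_neutral_left) (auto simp: e_def)
  finally have "w = (\<Sum>j\<le>m. (a j + e j) * x ^ j)"
    unfolding wa by (simp add: sum.distrib distrib_right)
  moreover have "\<forall>j. a j + e j \<in> A"
    using dA a A subring_0[OF A] by (auto simp: e_def intro!: subring_add)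
  ultimately show ?thesis by (intro exI[of _ "\<lambda>j. a j + e j"]) simp
qed

text \<open>Descent on the sum of the two degrees, always shortening the longer expression.\<close>

lemma no_two_expressions:
  fixes x w :: "'a::field"
  assumes A: "subring A" and wA: "w \<notin> A" and wu: "w * u = 1" and uA: "u \<in> A"
    and units: "\<And>b. b \<in> A \<Longrightarrow> inverse (1 - u * b) \<in> A \<and> 1 - u * b \<noteq> 0"
  shows "\<lbrakk>m + k = s; x \<noteq> 0; \<forall>i. a i \<in> A; w = (\<Sum>i\<le>m. a i * x ^ i);
     \<forall>i. b i \<in> A; w = (\<Sum>i\<le>k. b i * inverse x ^ i)\<rbrakk> \<Longrightarrow> False"
proof (induction s arbitrary: m k a b x rule: less_induct)
  case (less s)
  show ?case
  proof (cases "k \<le> m")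
    case True
    show ?thesis
    proof (cases m)
      case 0
      thus ?thesis using less.prems(3,4) wA by simp
    next
      case (Suc m')
      from shorten_expression[OF A less.prems(2) wu uA units less.prems(3) _ less.prems(5,6), of m']
      obtain a' where "\<forall>i. a' i \<in> A" "w = (\<Sum>i\<le>m'. a' i * x ^ i)"
        using less.prems(4) Suc True by auto
      thus ?thesis using less.IH[of "m' + k" m' k x a' b] less.prems Suc by simp
    qed
  next
    case False
    show ?thesis
    proof (cases k)
      case 0
      thus ?thesis using less.prems(5,6) wA by simp
    next
      case (Suc k')
      from shorten_expression[OF A _ wu uA units less.prems(5) _ less.prems(3), of "inverse x" k' m]
      obtain b' where "\<forall>i. b' i \<in> A" "w = (\<Sum>i\<le>k'. b' i * inverse x ^ i)"
        using less.prems(2,4,6) Suc False by auto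
      thus ?thesis using less.IH[of "m + k'" m k' x a b'] less.prems Suc by simp
    qed
  qed
qed

text \<open>For \<open>x\<close> outside \<open>A\<close>, maximality puts \<open>w\<close> into \<open>A[x]\<close>; if \<open>1 / x\<close> is outside too, two expressions of \<open>w\<close> collide.
That \<open>1 - u b\<close> is a unit follows by the same principle, since inverting it cannot introduce \<open>w\<close>.\<close>

lemma maximal_subring_avoiding:
  fixes w :: "'a::field"
  assumes A: "subring A" and wA: "w \<notin> A" and wu: "w * u = 1" and uA: "u \<in> A"
    and maxi: "\<And>B. subring B \<Longrightarrow> A \<subseteq> B \<Longrightarrow> w \<notin> B \<Longrightarrow> B = A"
  shows "valuation_ring A"
proof -
  have in_ad: "w \<in> adjoin A x" if "x \<notin> A" for x
    using maxi[OF subring_adjoin[OF A, of x] subset_adjoin[OF A, of x]] in_adjoin[OF A, of x] that by auto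
  \<comment> \<open>If \<open>u b = 1\<close> then \<open>b = w\<close>, which is not in \<open>A\<close>.\<close>
  have nz: "1 - u * b \<noteq> 0" if "b \<in> A" for b
  proof
    assume "1 - u * b = 0"
    hence "w = w * (u * b)" by simp
    hence "w = b" using wu by (simp add: mult.assoc[symmetric])
    thus False using that wA by simp
  qed
  have units: "inverse (1 - u * b) \<in> A" if b: "b \<in> A" for b
  proof (rule ccontr)
    assume "inverse (1 - u * b) \<notin> A"
    from in_ad[OF this] obtain a m where a: "\<forall>i. a i \<in> A"
      and w: "w = (\<Sum>i\<le>m. a i * inverse (1 - u * b) ^ i)" by (rule adjoinE)
    define y where "y = 1 - u * b"
    have y0: "y \<noteq> 0" using nz[OF b] by (simp add: y_def)
    have yA: "y \<in> A" unfolding y_def using A uA b by (auto intro: subring_1 subring_diff subring_mult)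
    have "w * y ^ m = (\<Sum>i\<le>m. a i * (inverse y ^ i * y ^ m))"
      unfolding w y_def[symmetric] by (simp add: sum_distrib_right mult.assoc)
    also have "\<dots> = (\<Sum>i\<le>m. a i * y ^ (m - i))"
      by (rule sum.cong) (use y0 in \<open>auto simp: power_diff field_simps\<close>)
    also have "\<dots> \<in> A" using A a yA by (auto intro!: subring_sum subring_mult subring_power)
    finally have wy: "w * y ^ m \<in> A" .
    have "\<exists>c\<in>A. y ^ j = 1 - u * c" for j
    proof (induction j)
      case 0 show ?case using subring_0[OF A] by auto
    next
      case (Suc j)
      then obtain c where c: "c \<in> A" "y ^ j = 1 - u * c" by auto
      have "y ^ Suc j = (1 - u * b) * (1 - u * c)" using c by (simp add: y_def)
      also have "\<dots> = 1 - u * (b + c - u * b * c)" by (simp add: algebra_simps)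
      finally have "y ^ Suc j = 1 - u * (b + c - u * b * c)" .
      moreover have "b + c - u * b * c \<in> A" using A b c uA by (auto intro!: subring_add subring_diff subring_mult)
      ultimately show ?case by blast
    qed
    then obtain c where c: "c \<in> A" "y ^ m = 1 - u * c" by blast
    \<comment> \<open>The powers of \<open>1 - u b\<close> stay in \<open>1 - u A\<close>, and \<open>w u = 1\<close>, so
      \<open>w\<close> would differ from \<open>w y\<^sup>m\<close> by an element of \<open>A\<close>.\<close>
    have "w * y ^ m = w - c" unfolding c using wu by (simp add: algebra_simps flip: mult.assoc)
    hence "w = w * y ^ m + c" by simp
    hence "w \<in> A" using wy c A by (metis subring_add)
    thus False using wA by simp
  qed
  have "x \<in> A \<or> inverse x \<in> A" for x
  proof (rule ccontr)
    assume H: "\<not> (x \<in> A \<or> inverse x \<in> A)"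
    hence x0: "x \<noteq> 0" using subring_0[OF A] by auto
    from H have "x \<notin> A" "inverse x \<notin> A" by auto
    from in_ad[OF this(1)] obtain a m where "\<forall>i. a i \<in> A" "w = (\<Sum>i\<le>m. a i * x ^ i)" by (rule adjoinE)
    moreover from in_ad[OF \<open>inverse x \<notin> A\<close>] obtain b k where "\<forall>i. b i \<in> A" "w = (\<Sum>i\<le>k. b i * inverse x ^ i)"
      by (rule adjoinE)
    ultimately show False using no_two_expressions[OF A wA wu uA _ refl x0] units nz by blast
  qed
  thus ?thesis using A by (simp add: valuation_ring_def)
qed

text \<open>The hypothesis says that \<open>w\<close> is not integral over \<open>R\<close>: a polynomial expression of \<open>w\<close> in \<open>1 / w\<close> becomes an
integral equation after multiplication by a power of \<open>w\<close>. The ring \<open>R[1 / w]\<close> avoids \<open>w\<close>, and Zorn's lemma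
enlarges it to a maximal such ring.\<close>

lemma exists_valuation_ring:
  fixes w :: "'a::field"
  assumes R: "subring R" and w: "w \<notin> adjoin R (inverse w)"
  obtains A where "valuation_ring A" "R \<subseteq> A" "w \<notin> A"
proof -
  define S where "S = {B. subring B \<and> adjoin R (inverse w) \<subseteq> B \<and> w \<notin> B}"
  have R': "subring (adjoin R (inverse w))" using R by (rule subring_adjoin)
  have ne: "S \<noteq> {}" using w R' by (auto simp: S_def)
  have w0: "w \<noteq> 0" using w subring_0[OF R'] by auto
  have "\<exists>M\<in>S. \<forall>X\<in>S. M \<subseteq> X \<longrightarrow> X = M"
  proof (rule subset_Zorn_nonempty[OF ne])
    fix C assume C: "C \<noteq> {}" "subset.chain S C"
    have sub: "subring B" "adjoin R (inverse w) \<subseteq> B" "w \<notin> B" if "B \<in> C" for B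
      using C that by (auto simp: subset.chain_def S_def)
    have "subring (\<Union>C)"
      unfolding subring_def
    proof (intro conjI ballI)
      show "1 \<in> \<Union>C" using C sub subring_1 by blast
      fix x y assume "x \<in> \<Union>C" "y \<in> \<Union>C"
      then obtain B B' where B: "B \<in> C" "x \<in> B" "B' \<in> C" "y \<in> B'" by auto
      hence "B \<subseteq> B' \<or> B' \<subseteq> B" using C by (auto simp: subset.chain_def)
      then obtain D where "D \<in> C" "x \<in> D" "y \<in> D" using B by auto
      thus "x - y \<in> \<Union>C" "x * y \<in> \<Union>C" using sub[of D] by (auto simp: subring_def)
    qed
    moreover have "adjoin R (inverse w) \<subseteq> \<Union>C" using C(1) sub(2) by blast
    ultimately show "\<Union>C \<in> S" using sub(3) by (auto simp: S_def)
  qed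
  then obtain M where M: "M \<in> S" "\<And>X. X \<in> S \<Longrightarrow> M \<subseteq> X \<Longrightarrow> X = M" by blast
  have "valuation_ring M"
  proof (rule maximal_subring_avoiding)
    show "w * inverse w = 1" using w0 by simp
    show "inverse w \<in> M" using M in_adjoin[OF R] by (auto simp: S_def)
    show "B = M" if "subring B" "M \<subseteq> B" "w \<notin> B" for B
      using that M by (auto simp: S_def)
  qed (use M in \<open>auto simp: S_def\<close>)
  thus ?thesis using that[of M] M subset_adjoin[OF R, of "inverse w"] by (auto simp: S_def)
qed

section \<open>The preorder of a valuation ring\<close>

text \<open>Comparison of valuations without a value group: \<open>x\<close> is at most \<open>y\<close> in absolute value.\<close>

definition vle :: "'a::field set \<Rightarrow> 'a \<Rightarrow> 'a \<Rightarrow> bool" where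
  "vle A x y \<longleftrightarrow> (\<exists>a\<in>A. x = a * y)"

context
  fixes A :: "'a::field set"
  assumes A: "valuation_ring A"
begin

lemma val_subring: "subring A"
  using A by (simp add: valuation_ring_def)

lemma vle_refl: "vle A x x"
  using subring_1[OF val_subring] by (force simp: vle_def)

lemma vle_trans: "vle A x y \<Longrightarrow> vle A y z \<Longrightarrow> vle A x z"
  unfolding vle_def by (metis mult.assoc subring_mult[OF val_subring])

lemma vle_total: "vle A x y \<or> vle A y x"
proof (cases "x = 0 \<or> y = 0")
  case True
  thus ?thesis using subring_0[OF val_subring] by (force simp: vle_def)
next
  case False
  have "x / y \<in> A \<or> inverse (x / y) \<in> A" using A unfolding valuation_ring_def by blast
  thus ?thesis
  proof
    assume "x / y \<in> A" thus ?thesis using False unfolding vle_def by (intro disjI1 bexI[of _ "x / y"]) auto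
  next
    assume "inverse (x / y) \<in> A" thus ?thesis using False unfolding vle_def
      by (intro disjI2 bexI[of _ "inverse (x / y)"]) auto
  qed
qed

lemma vle_0: "vle A x 0 \<longleftrightarrow> x = 0"
  using vle_refl by (auto simp: vle_def)

lemma vle_mult: "vle A x y \<Longrightarrow> vle A z w \<Longrightarrow> vle A (x * z) (y * w)"
  unfolding vle_def by (metis mult.assoc mult.left_commute subring_mult[OF val_subring])

lemma vle_mult_cancel: "vle A (c * x) (c * y) \<Longrightarrow> c \<noteq> 0 \<Longrightarrow> vle A x y"
  unfolding vle_def by (metis mult.left_commute mult_left_cancel)

lemma vle_add: "vle A x z \<Longrightarrow> vle A y z \<Longrightarrow> vle A (x + y) z"
  unfolding vle_def by (metis distrib_right subring_add[OF val_subring])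

lemma vle_uminus: "vle A x (- y) \<Longrightarrow> vle A x y"
  unfolding vle_def by (metis mult_minus_left mult_minus_right subring_uminus[OF val_subring])

lemma vle_in: "vle A x y \<Longrightarrow> y \<in> A \<Longrightarrow> x \<in> A"
  unfolding vle_def using subring_mult[OF val_subring] by blast

lemma square_root_in_valuation_ring:
  assumes "x * x \<in> A"
  shows "x \<in> A"
proof -
  have "vle A x 1 \<or> vle A 1 x" by (rule vle_total)
  thus ?thesis
  proof
    assume "vle A x 1" thus ?thesis using vle_in subring_1[OF val_subring] by blast
  next
    assume "vle A 1 x"
    hence "vle A x (x * x)" using vle_mult[OF vle_refl[of x], of 1 x] by simp
    thus ?thesis using vle_in assms by blast
  qed
qed

text \<open>The ultrametric inequality: a sum is not larger than its largest term.\<close>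

lemma vle_sum_term:
  assumes "finite I" "vle A z (\<Sum>i\<in>I. f i)" "z \<noteq> 0"
  shows "\<exists>i\<in>I. vle A z (f i)"
  using assms(1,2)
proof (induction I rule: finite_induct)
  case empty
  thus ?case using assms(3) vle_0 by simp
next
  case (insert i I)
  from insert.prems have le: "vle A z (f i + sum f I)" using insert.hyps by simp
  show ?case
  proof (cases "vle A (sum f I) (f i)")
    case True
    hence "vle A (f i + sum f I) (f i)" using vle_add vle_refl by blast
    thus ?thesis using vle_trans[OF le] by blast
  next
    case False
    hence "vle A (f i) (sum f I)" using vle_total by blast
    hence "vle A (f i + sum f I) (sum f I)" using vle_add vle_refl by blast
    thus ?thesis using vle_trans[OF le] insert.IH by blast
  qed
qed

lemma ex_vle_max:
  assumes "finite S" "S \<noteq> {}"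
  shows "\<exists>w\<in>S. \<forall>u\<in>S. vle A (f u) (f w)"
  using assms
proof (induction S rule: finite_ne_induct)
  case (singleton x)
  thus ?case using vle_refl by auto
next
  case (insert x F)
  then obtain w where w: "w \<in> F" "\<forall>u\<in>F. vle A (f u) (f w)" by blast
  show ?case
  proof (cases "vle A (f x) (f w)")
    case True thus ?thesis using w by auto
  next
    case False
    hence "vle A (f w) (f x)" using vle_total by blast
    thus ?thesis using w vle_trans vle_refl by (intro bexI[of _ x]) auto
  qed
qed

section \<open>Matched points with dominating distances\<close>

text \<open>The points of \<open>S\<close> are matched in pairs by \<open>\<pi>\<close>. No entry \<open>l w w'\<close> between different pairs exceeds the entries
of the two pairs, and it can reach the size of a pair's entry only if \<open>w\<close> and \<open>w'\<close> are both at least the smaller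
point of that pair. Then the matrix of \<open>l\<close> on \<open>S\<close> is nonsingular. For a kernel vector \<open>c\<close>, look
at the points \<open>w\<close> maximising \<open>c\<^sub>w\<^sup>2 l w (\<pi> w)\<close>: in the row of \<open>\<pi> w\<close> the entry of \<open>w\<close> must be balanced by another
maximiser \<open>u\<close> with an entry of full size, and the condition on smaller points makes the passage from \<open>w\<close> to \<open>u\<close>
monotone in the order of the points, which cannot go on forever.\<close>

lemma matching_dominant_nonsingular:
  fixes l :: "nat \<Rightarrow> nat \<Rightarrow> 'a" and \<pi> :: "nat \<Rightarrow> nat"
  assumes S: "finite S"
    and sym: "\<And>u v. l u v = l v u" and diag: "\<And>u. l u u = 0"
    and \<pi>: "\<And>w. w \<in> S \<Longrightarrow> \<pi> w \<in> S \<and> \<pi> (\<pi> w) = w \<and> \<pi> w \<noteq> w \<and> l w (\<pi> w) \<noteq> 0"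
    and cross: "\<And>w w'. w \<in> S \<Longrightarrow> w' \<in> S \<Longrightarrow> w' \<noteq> w \<Longrightarrow> w' \<noteq> \<pi> w \<Longrightarrow>
       vle A (l w w') (l w' (\<pi> w')) \<and>
       (vle A (l w' (\<pi> w')) (l w w') \<longrightarrow> min w' (\<pi> w') \<le> min w w')"
    and ker: "\<And>w'. w' \<in> S \<Longrightarrow> (\<Sum>w\<in>S. c w * l w w') = 0"
    and w0: "w0 \<in> S"
  shows "c w0 = 0"
proof (rule ccontr)
  assume c0: "c w0 \<noteq> 0"
  define f where "f = (\<lambda>w. c w * c w * l w (\<pi> w))"
  define T where "T = {w\<in>S. \<forall>u\<in>S. vle A (f u) (f w)}"
  have TS: "w \<in> S" if "w \<in> T" for w using that by (simp add: T_def)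
  have Tne: "T \<noteq> {}" using ex_vle_max[OF S, of f] w0 by (auto simp: T_def)
  have f0: "f w \<noteq> 0" if "w \<in> T" for w
  proof
    assume "f w = 0"
    hence "vle A (f w0) 0" using that w0 by (auto simp: T_def)
    hence "f w0 = 0" by (simp add: vle_0)
    thus False using c0 \<pi>[OF w0] by (simp add: f_def)
  qed
  have step: "\<exists>u\<in>T. u \<noteq> w \<and> u \<noteq> \<pi> w \<and> min w (\<pi> w) \<le> min u (\<pi> w) \<and> min u (\<pi> u) \<le> min u (\<pi> w)"
    if w: "w \<in> T" for w
  proof -
    note wS = TS[OF w]
    note pw = \<pi>[OF wS]
    define y where "y = l w (\<pi> w)"
    have y0: "y \<noteq> 0" "c w \<noteq> 0" using f0[OF w] by (auto simp: f_def y_def)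
    have "0 = (\<Sum>u\<in>S. c u * l u (\<pi> w))" using ker pw by simp
    also have "\<dots> = c w * y + (\<Sum>u\<in>S - {w}. c u * l u (\<pi> w))"
      unfolding y_def by (rule sum.remove[OF S wS])
    finally have "c w * y = - (\<Sum>u\<in>S - {w}. c u * l u (\<pi> w))" by (simp add: eq_neg_iff_add_eq_0)
    hence "vle A (c w * y) (\<Sum>u\<in>S - {w}. c u * l u (\<pi> w))"
      using vle_uminus vle_refl by metis
    from vle_sum_term[OF _ this] y0 S obtain u where u: "u \<in> S" "u \<noteq> w"
      "vle A (c w * y) (c u * l u (\<pi> w))" by auto
    define L where "L = l u (\<pi> w)"
    have L: "vle A (c w * y) (c u * L)" using u by (simp add: L_def)
    have cL: "c u \<noteq> 0" "L \<noteq> 0" using L y0 by (auto simp: vle_0)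
    have ne: "u \<noteq> \<pi> w" using cL diag by (auto simp: L_def)
    hence ne': "\<pi> w \<noteq> \<pi> u" "\<pi> w \<noteq> u" "u \<noteq> \<pi> (\<pi> w)" using \<pi>[OF u(1)] pw u(2) by metis+
    define yu where "yu = l u (\<pi> u)"
    have c1: "vle A L y \<and> (vle A y L \<longrightarrow> min w (\<pi> w) \<le> min u (\<pi> w))"
      using cross[of u "\<pi> w"] u(1) pw ne' sym[of w] unfolding L_def y_def by (simp add: min.commute)
    have c2: "vle A L yu \<and> (vle A yu L \<longrightarrow> min u (\<pi> u) \<le> min u (\<pi> w))"
      using cross[of "\<pi> w" u] u(1) pw ne' u(2) sym[of u] unfolding L_def yu_def by (simp add: min.commute)
    have fu: "vle A (f u) (f w)" using w u(1) by (simp add: T_def)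
    have "vle A (c w * y * (c w * y)) (c u * L * (c u * L))" using L by (rule vle_mult[OF L])
    \<comment> \<open>Squared, the balance of \<open>w\<close> by \<open>u\<close> reads \<open>f w y \<le> c\<^sub>u\<^sup>2
      L\<^sup>2\<close>. Together with \<open>L \<le> y\<close>, \<open>L \<le> yu\<close> and \<open>f u \<le> f w\<close> it
      forces equality everywhere.\<close>
    hence sq: "vle A (f w * y) (c u * c u * L * L)" by (simp add: f_def y_def mult_ac)
    have "vle A (c u * c u * L) (c u * c u * yu)" using c2 vle_mult[OF vle_refl] by blast
    hence "vle A (c u * c u * L * L) (f u * L)"
      unfolding f_def yu_def[symmetric] by (rule vle_mult[OF _ vle_refl])
    with sq have ch: "vle A (f w * y) (f u * L)" by (rule vle_trans)
    have ch2: "vle A (f u * L) (f w * L)" using fu by (rule vle_mult[OF _ vle_refl])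
    have yL: "vle A y L" using vle_trans[OF ch ch2] f0[OF w] by (rule vle_mult_cancel)
    have "vle A (f w * L) (f w * y)" using c1 vle_mult[OF vle_refl] by blast
    from vle_trans[OF vle_trans[OF ch2 this] sq]
    have "vle A ((c u * c u * L) * yu) ((c u * c u * L) * L)"
      by (simp add: f_def yu_def mult_ac)
    hence yuL: "vle A yu L" by (rule vle_mult_cancel) (use cL in auto)
    have "vle A (f u * L) (f u * y)" using c1 vle_mult[OF vle_refl] by blast
    from vle_trans[OF ch this] have "vle A (y * f w) (y * f u)" by (simp add: mult.commute)
    hence "vle A (f w) (f u)" using y0(1) by (rule vle_mult_cancel)
    hence "u \<in> T" using w u(1) vle_trans by (auto simp: T_def)
    thus ?thesis using u(2) ne c1 c2 yL yuL by blast
  qed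
  have finT: "finite T" using S by (auto simp: T_def)
  show False
  \<comment> \<open>If some maximiser is the larger point of its pair, \<open>step\<close> leads to one in a pair with a smaller
    least point. If all are the smaller points of their pairs, \<open>step\<close> leads to a larger maximiser.\<close>
  proof (cases "\<exists>w\<in>T. \<pi> w < w")
    case True
    define m where "m = Min (\<pi> ` {w\<in>T. \<pi> w < w})"
    have "m \<in> \<pi> ` {w\<in>T. \<pi> w < w}" unfolding m_def by (rule Min_in) (use finT True in auto)
    then obtain w where w: "w \<in> T" "\<pi> w < w" "m = \<pi> w" by auto
    from step[OF w(1)] obtain u where u: "u \<in> T" "u \<noteq> w" "u \<noteq> \<pi> w"
      "min w (\<pi> w) \<le> min u (\<pi> w)" "min u (\<pi> u) \<le> min u (\<pi> w)" by blast
    have "\<pi> u \<noteq> \<pi> w" using \<pi>[OF TS[OF u(1)]] \<pi>[OF TS[OF w(1)]] u(2) by metis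
    hence "\<pi> u < u" "\<pi> u < m" using u w by auto
    moreover have "m \<le> \<pi> u" unfolding m_def by (rule Min_le) (use finT u \<open>\<pi> u < u\<close> in auto)
    ultimately show False by simp
  next
    case False
    define w where "w = Max T"
    have w: "w \<in> T" unfolding w_def by (rule Max_in) (use finT Tne in auto)
    from step[OF w] obtain u where u: "u \<in> T" "u \<noteq> w" "min w (\<pi> w) \<le> min u (\<pi> w)" by blast
    have "w < \<pi> w" using False w \<pi>[OF TS[OF w]] by force
    hence "w < u" using u by auto
    moreover have "u \<le> w" unfolding w_def by (rule Max_ge) (use finT u in auto)
    ultimately show False by simp
  qed
qed

end

text \<open>Gaussian elimination of the last coordinate.\<close>

lemma linear_dependence:
  fixes \<phi> :: "'b \<Rightarrow> nat \<Rightarrow> 'a::field"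
  assumes "finite S" "m < card S"
  shows "\<exists>c. (\<exists>w\<in>S. c w \<noteq> 0) \<and> (\<forall>j<m. (\<Sum>w\<in>S. c w * \<phi> w j) = 0)"
  using assms
proof (induction m arbitrary: S \<phi>)
  case 0
  then obtain w where "w \<in> S" by (cases "S = {}") auto
  thus ?case by (intro exI[of _ "\<lambda>_. 1"]) auto
next
  case (Suc m)
  show ?case
  proof (cases "\<forall>w\<in>S. \<phi> w m = 0")
    case True
    from Suc.IH[OF Suc.prems(1), of \<phi>] Suc.prems(2) obtain c where
      c: "\<exists>w\<in>S. c w \<noteq> 0" "\<forall>j<m. (\<Sum>w\<in>S. c w * \<phi> w j) = 0" by auto
    moreover have "(\<Sum>w\<in>S. c w * \<phi> w m) = 0" using True by simp
    ultimately show ?thesis by (metis less_Suc_eq)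
  next
    case False
    then obtain w0 where w0: "w0 \<in> S" "\<phi> w0 m \<noteq> 0" by auto
    define r where "r = (\<lambda>w. \<phi> w m / \<phi> w0 m)"
    have "m < card (S - {w0})" using Suc.prems w0 by simp
    from Suc.IH[OF _ this, of "\<lambda>w j. \<phi> w j - r w * \<phi> w0 j"] Suc.prems(1) obtain c where
      c: "\<exists>w\<in>S - {w0}. c w \<noteq> 0" "\<forall>j<m. (\<Sum>w\<in>S - {w0}. c w * (\<phi> w j - r w * \<phi> w0 j)) = 0" by auto
    define c' where "c' = (\<lambda>w. if w = w0 then - (\<Sum>w\<in>S - {w0}. c w * r w) else c w)"
    have eq: "(\<Sum>w\<in>S. c' w * \<phi> w j) = (\<Sum>w\<in>S - {w0}. c w * (\<phi> w j - r w * \<phi> w0 j))" for j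
    proof -
      have "(\<Sum>w\<in>S. c' w * \<phi> w j) = c' w0 * \<phi> w0 j + (\<Sum>w\<in>S - {w0}. c w * \<phi> w j)"
        by (subst sum.remove[OF Suc.prems(1) w0(1)]) (auto simp: c'_def intro!: sum.cong)
      also have "\<dots> = (\<Sum>w\<in>S - {w0}. c w * (\<phi> w j - r w * \<phi> w0 j))"
        by (simp add: c'_def sum_subtractf right_diff_distrib sum_distrib_right mult.assoc)
      finally show ?thesis .
    qed
    have "\<forall>j<Suc m. (\<Sum>w\<in>S. c' w * \<phi> w j) = 0"
    proof (intro allI impI)
      fix j assume "j < Suc m"
      thus "(\<Sum>w\<in>S. c' w * \<phi> w j) = 0"
        unfolding eq using c(2) w0 by (cases "j = m") (auto simp: r_def intro!: sum.neutral)
    qed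
    moreover have "\<exists>w\<in>S. c' w \<noteq> 0" using c(1) by (auto simp: c'_def)
    ultimately show ?thesis by blast
  qed
qed

section \<open>Simplicial chains\<close>

type_synonym chain = "nat set \<Rightarrow> int"

text \<open>The sign of sorting \<open>v\<close> into the increasing list of the elements of \<open>s\<close>.\<close>

definition shuffle_sign :: "nat \<Rightarrow> nat set \<Rightarrow> int" where
  "shuffle_sign v s = (- 1) ^ card {u \<in> s. u < v}"

text \<open>An integer function on sets of vertices represents an element of the exterior algebra on the vertices, a set
standing for the product of its elements in increasing order. In these terms \<open>contract v\<close> is the contraction
with the coordinate function of \<open>v\<close>, \<open>wedge v\<close> is the left multiplication by \<open>v\<close>, and the simplicial boundary
is the contraction with the sum of all coordinate functions. The sign rules of chains become the
anticommutation relations of these operators.\<close>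

definition contract :: "nat \<Rightarrow> chain \<Rightarrow> chain" where
  "contract v c = (\<lambda>s. if v \<in> s then 0 else shuffle_sign v s * c (insert v s))"

definition wedge :: "nat \<Rightarrow> chain \<Rightarrow> chain" where
  "wedge v c = (\<lambda>s. if v \<in> s then shuffle_sign v (s - {v}) * c (s - {v}) else 0)"

definition boundary :: "nat set \<Rightarrow> chain \<Rightarrow> chain" where
  "boundary V c = (\<lambda>s. \<Sum>v\<in>V. contract v c s)"

lemma shuffle_sign_square: "shuffle_sign v s * shuffle_sign v s = 1"
  by (simp add: shuffle_sign_def flip: power_add mult_2)

lemma shuffle_sign_square': "shuffle_sign v s * (shuffle_sign v s * x) = x"
  by (simp add: shuffle_sign_square flip: mult.assoc)

lemma shuffle_sign_insert:
  assumes "w \<notin> s"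
  shows "shuffle_sign v (insert w s) = (if w < v then - 1 else 1) * shuffle_sign v s"
proof -
  have "finite {u \<in> s. u < v}" by (rule finite_subset[of _ "{..<v}"]) auto
  moreover have "{u \<in> insert w s. u < v} = (if w < v then insert w {u \<in> s. u < v} else {u \<in> s. u < v})"
    using assms by auto
  ultimately show ?thesis using assms by (simp add: shuffle_sign_def)
qed

lemma contract_anticommute: "contract v (contract w c) s = - contract w (contract v c) s"
proof (cases "v = w \<or> v \<in> s \<or> w \<in> s")
  case False
  thus ?thesis
    by (auto simp: contract_def shuffle_sign_insert insert_commute)
qed (auto simp: contract_def)

lemma contract_wedge_same: "contract v (wedge v c) s = c s - wedge v (contract v c) s"
  by (auto simp: contract_def wedge_def shuffle_sign_square' insert_absorb)

lemma contract_wedge_diff: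
  assumes "v \<noteq> w"
  shows "contract v (wedge w c) s = - wedge w (contract v c) s"
proof (cases "w \<in> s \<and> v \<notin> s")
  case True
  define t where "t = s - {w}"
  have t: "s = insert w t" "w \<notin> t" "v \<notin> t" using True assms by (auto simp: t_def)
  have [simp]: "insert v (insert w t) - {w} = insert v t" "insert w t - {w} = t" using t assms by auto
  show ?thesis using t assms
    by (auto simp: contract_def wedge_def shuffle_sign_insert)
qed (use assms in \<open>auto simp: contract_def wedge_def\<close>)

lemma wedge_anticommute: "wedge v (wedge w c) s = - wedge w (wedge v c) s"
proof (cases "v \<noteq> w \<and> v \<in> s \<and> w \<in> s")
  case True
  define t where "t = s - {v, w}"
  have t: "s = insert v (insert w t)" "w \<notin> t" "v \<notin> t" using True by (auto simp: t_def)
  have [simp]: "insert v (insert w t) - {w} = insert v t" "insert v (insert w t) - {v} = insert w t"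
    "insert w t - {w} = t" "insert v t - {v} = t" using t True by auto
  show ?thesis using t True
    by (auto simp: wedge_def shuffle_sign_insert)
qed (auto simp: wedge_def)

lemma contract_diff: "contract v (\<lambda>s. c s - d s) s = contract v c s - contract v d s"
  and contract_add: "contract v (\<lambda>s. c s + d s) s = contract v c s + contract v d s"
  and contract_uminus: "contract v (\<lambda>s. - c s) s = - contract v c s"
  and contract_sum: "contract v (\<lambda>s. \<Sum>i\<in>I. h i s) s = (\<Sum>i\<in>I. contract v (h i) s)"
  and wedge_sum: "wedge v (\<lambda>s. \<Sum>i\<in>I. h i s) s = (\<Sum>i\<in>I. wedge v (h i) s)"
  and wedge_0: "wedge v (\<lambda>s. 0) s = 0"
  by (auto simp: contract_def wedge_def algebra_simps sum_distrib_left)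

lemma boundary_diff: "boundary V (\<lambda>s. c s - d s) s = boundary V c s - boundary V d s"
  by (simp add: boundary_def contract_diff sum_subtractf)

lemma boundary_sum: "boundary V (\<lambda>s. \<Sum>i\<in>I. h i s) s = (\<Sum>i\<in>I. boundary V (h i) s)"
  unfolding boundary_def contract_sum by (rule sum.swap)

lemma boundary_contract: "boundary V (contract v c) s = - contract v (boundary V c) s"
  unfolding boundary_def contract_sum
  by (subst contract_anticommute) (simp add: sum_negf)

lemma boundary_boundary: "boundary V (boundary V c) s = 0"
proof -
  have "boundary V (boundary V c) s = (\<Sum>v\<in>V. boundary V (contract v c) s)"
    unfolding boundary_def[of V c] by (rule boundary_sum)
  also have "\<dots> = - (\<Sum>v\<in>V. contract v (boundary V c) s)"
    by (simp add: boundary_contract sum_negf)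
  also have "\<dots> = - boundary V (boundary V c) s"
    by (simp add: boundary_def[of V "boundary V c"])
  finally show ?thesis by simp
qed

text \<open>The Leibniz rule; for a cycle \<open>c\<close> it exhibits \<open>c\<close> as the boundary of its cone with apex \<open>v\<close>.\<close>

lemma boundary_wedge:
  assumes "finite V" "v \<in> V"
  shows "boundary V (wedge v c) s = c s - wedge v (boundary V c) s"
proof -
  have "contract w (wedge v c) s = (if w = v then c s else 0) - wedge v (contract w c) s" for w
    using contract_wedge_same[of v c s] contract_wedge_diff[of w v c s] by auto
  thus ?thesis using assms
    by (simp add: boundary_def wedge_sum sum_subtractf)
qed

section \<open>Cycles after deleting edges from a full simplex\<close>

definition supported :: "nat \<Rightarrow> nat set set \<Rightarrow> chain \<Rightarrow> bool" where
  "supported d X c \<longleftrightarrow> (\<forall>s. c s \<noteq> 0 \<longrightarrow> s \<in> X \<and> finite s \<and> card s = d)"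

text \<open>The flag complex on \<open>N\<close> of the graph whose missing edges are listed in \<open>es\<close>. The head of the list is the
edge deleted last.\<close>

definition cut_complex :: "(nat \<times> nat) list \<Rightarrow> nat set \<Rightarrow> nat set set" where
  "cut_complex es N = {s. s \<subseteq> N \<and> (\<forall>(u, v)\<in>set es. \<not> (u \<in> s \<and> v \<in> s))}"

fun common_link :: "(nat \<times> nat) \<Rightarrow> (nat \<times> nat) list \<Rightarrow> nat set \<Rightarrow> nat set" where
  "common_link (u, v) es N =
     {w \<in> N. w \<noteq> u \<and> w \<noteq> v \<and> (\<forall>x\<in>{u, v}. (w, x) \<notin> set es \<and> (x, w) \<notin> set es)}"

text \<open>An obstruction to filling cycles: the pairs \<open>ps\<close> are deleted edges, each one lying in the link that its
predecessors had at the moment of their deletion. Since the edges between different pairs were still present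
at that moment, the pairs are the axes of a cross polytope.\<close>

fun cross_polytope :: "(nat \<times> nat) list \<Rightarrow> (nat \<times> nat) list \<Rightarrow> nat set \<Rightarrow> bool" where
  "cross_polytope [] es N = True"
| "cross_polytope (p # ps) [] N = False"
| "cross_polytope (p # ps) (e # es) N \<longleftrightarrow>
     cross_polytope (p # ps) es N \<or>
     (p = e \<and> fst e \<in> N \<and> snd e \<in> N \<and> cross_polytope ps es (common_link e es N))"

lemma supported_wedge:
  assumes "supported d X c" "\<And>s. s \<in> X \<Longrightarrow> insert v s \<in> Y"
  shows "supported (Suc d) Y (wedge v c)"
  unfolding supported_def
proof (intro allI impI)
  fix s assume "wedge v c s \<noteq> 0"
  hence v: "v \<in> s" "c (s - {v}) \<noteq> 0" by (auto simp: wedge_def split: if_splits)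
  with assms(1) have "s - {v} \<in> X" "finite (s - {v})" "card (s - {v}) = d" by (auto simp: supported_def)
  thus "s \<in> Y \<and> finite s \<and> card s = Suc d"
    using assms(2)[of "s - {v}"] v by (metis card_Suc_Diff1 finite_Diff_insert finite.emptyI insert_Diff finite_insert)
qed

lemma supported_contract:
  assumes "supported d X c" "\<And>s. insert v s \<in> X \<Longrightarrow> v \<notin> s \<Longrightarrow> s \<in> Y"
  shows "supported (d - 1) Y (contract v c)"
  unfolding supported_def
proof (intro allI impI)
  fix s assume "contract v c s \<noteq> 0"
  hence v: "v \<notin> s" "c (insert v s) \<noteq> 0" by (auto simp: contract_def split: if_splits)
  with assms(1) have "insert v s \<in> X" "finite (insert v s)" "card (insert v s) = d" by (auto simp: supported_def)
  thus "s \<in> Y \<and> finite s \<and> card s = d - 1"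
    using assms(2)[of "s"] v by auto
qed

lemma supported_boundary:
  assumes "supported d X c" "\<And>v s. insert v s \<in> X \<Longrightarrow> s \<in> X"
  shows "supported (d - 1) X (boundary V c)"
  unfolding supported_def
proof (intro allI impI)
  fix s assume "boundary V c s \<noteq> 0"
  then obtain v where "contract v c s \<noteq> 0" unfolding boundary_def by (meson sum.not_neutral_contains_not_neutral)
  moreover have "supported (d - 1) X (contract v c)"
    by (rule supported_contract[OF assms(1)]) (use assms(2) in blast)
  ultimately show "s \<in> X \<and> finite s \<and> card s = d - 1" by (auto simp: supported_def)
qed

lemma cut_complex_subset: "s \<in> cut_complex es N \<Longrightarrow> t \<subseteq> s \<Longrightarrow> t \<in> cut_complex es N"
  by (fastforce simp: cut_complex_def)

text \<open>Induction on the deleted edges. With no edge deleted every cycle bounds a cone. Otherwise \<open>z = \<partial>c\<close> for a chain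
\<open>c\<close> that may use the last deleted edge \<open>uv\<close>. The part of \<open>c\<close> on simplices containing \<open>uv\<close> is, up to the factor
\<open>u \<and> v\<close>, a cycle of the link of \<open>uv\<close>; if this cycle bounds a chain \<open>g\<close> there, then subtracting the boundary of
\<open>u \<and> v \<and> g\<close> from \<open>c\<close> removes all simplices containing \<open>uv\<close>.\<close>

lemma cycle_bounds_unless_cross_polytope:
  assumes V: "finite V"
  shows "\<lbrakk>N \<subseteq> V; \<forall>(u, v)\<in>set es. u \<noteq> v; \<not> (\<exists>ps. length ps = d \<and> cross_polytope ps es N);
      supported d (cut_complex es N) z; \<forall>s. boundary V z s = 0\<rbrakk> \<Longrightarrow>
    \<exists>c. supported (Suc d) (cut_complex es N) c \<and> (\<forall>s. boundary V c s = z s)"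
proof (induction es arbitrary: N d z)
  case Nil
  \<comment> \<open>The empty list of pairs is always a cross polytope. So \<open>d > 0\<close>, and the empty complex, whose only
    simplex is the empty set, carries no cycle of size \<open>d\<close>.\<close>
  have d: "d \<noteq> 0"
    using Nil.prems(3) cross_polytope.simps(1)[of "[]" N] by (metis list.size(3))
  show ?case
  proof (cases "N = {}")
    case True
    hence "z s = 0" for s using Nil.prems(4) d by (auto simp: supported_def cut_complex_def)
    thus ?thesis by (intro exI[of _ "\<lambda>_. 0"]) (auto simp: supported_def boundary_def contract_def intro!: sum.neutral)
  next
    case False
    then obtain v where v: "v \<in> N" by auto
    have "supported (Suc d) (cut_complex [] N) (wedge v z)"
      by (rule supported_wedge[OF Nil.prems(4)]) (use v in \<open>auto simp: cut_complex_def\<close>)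
    moreover have "boundary V (wedge v z) s = z s" for s
    proof -
      have "boundary V z = (\<lambda>s. 0)" using Nil.prems(5) by auto
      thus ?thesis using boundary_wedge[OF V, of v z s] v Nil.prems(1) by (auto simp: wedge_0)
    qed
    ultimately show ?thesis by blast
  qed
next
  case (Cons e es)
  obtain u v where e: "e = (u, v)" by force
  have uv: "u \<noteq> v" using Cons.prems(2) e by auto
  have d: "d \<noteq> 0"
    using Cons.prems(3) cross_polytope.simps(1)[of "e # es" N] by (metis list.size(3))
  have sub: "cut_complex (e # es) N \<subseteq> cut_complex es N" by (auto simp: cut_complex_def)
  have es: "\<forall>(u, v)\<in>set es. u \<noteq> v" using Cons.prems(2) by simp
  have no_cp: "\<not> (\<exists>ps. length ps = d \<and> cross_polytope ps es N)"
  proof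
    assume "\<exists>ps. length ps = d \<and> cross_polytope ps es N"
    then obtain ps where "length ps = d" "cross_polytope ps es N" by blast
    hence "length ps = d \<and> cross_polytope ps (e # es) N" by (cases ps) auto
    thus False using Cons.prems(3) by blast
  qed
  have "supported d (cut_complex es N) z"
    using Cons.prems(4) sub by (auto simp: supported_def)
  from Cons.IH[OF Cons.prems(1) es no_cp this Cons.prems(5)]
  obtain c where c: "supported (Suc d) (cut_complex es N) c" "\<forall>s. boundary V c s = z s"
    by blast
  show ?case
  proof (cases "u \<in> N \<and> v \<in> N")
    case False
    hence "cut_complex es N = cut_complex (e # es) N" by (auto simp: cut_complex_def e)
    thus ?thesis using c by auto
  next
    case True
    define N' where "N' = common_link e es N"
    have N': "N' \<subseteq> V" "u \<notin> N'" "v \<notin> N'" using Cons.prems(1) by (auto simp: N'_def e)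
    have join: "insert u (insert v s) \<in> cut_complex es N \<longleftrightarrow> s \<in> cut_complex es N' \<and> (u, v) \<notin> set es \<and> (v, u) \<notin> set es"
      if "u \<notin> s" "v \<notin> s" for s
      using that True Cons.prems(2) unfolding cut_complex_def N'_def e by (auto; blast)
    define c2 where "c2 = contract v (contract u c)"
    have c2: "supported (d - 1) (cut_complex es N') c2"
      unfolding supported_def
    proof (intro allI impI)
      fix s assume "c2 s \<noteq> 0"
      hence s: "u \<notin> s" "v \<notin> s" "c (insert u (insert v s)) \<noteq> 0"
        by (auto simp: c2_def contract_def split: if_splits)
      with c(1) have "insert u (insert v s) \<in> cut_complex es N" "finite s" "card (insert u (insert v s)) = Suc d"
        by (auto simp: supported_def)
      thus "s \<in> cut_complex es N' \<and> finite s \<and> card s = d - 1"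
        using s join[OF s(1,2)] uv by auto
    qed
    show ?thesis
    proof (cases "(u, v) \<in> set es \<or> (v, u) \<in> set es")
      case True
      hence "cut_complex es N = cut_complex (e # es) N" by (auto simp: cut_complex_def e)
      thus ?thesis using c by auto
    next
      case False
      have nocp: "\<not> (\<exists>ps. length ps = d - 1 \<and> cross_polytope ps es N')"
      proof
        assume "\<exists>ps. length ps = d - 1 \<and> cross_polytope ps es N'"
        then obtain ps where "length ps = d - 1" "cross_polytope ps es N'" by blast
        hence "length (e # ps) = d \<and> cross_polytope (e # ps) (e # es) N"
          using d \<open>u \<in> N \<and> v \<in> N\<close> by (auto simp: N'_def e)
        thus False using Cons.prems(3) by blast
      qed
      have bd: "boundary V c = z" using c(2) by auto
      have "boundary V c2 s = 0" for s
      proof -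
        have "boundary V c2 s = - contract v (boundary V (contract u c)) s"
          unfolding c2_def by (rule boundary_contract)
        also have "boundary V (contract u c) = (\<lambda>s. - contract u z s)"
          by (rule ext) (simp add: boundary_contract bd)
        also have "- contract v (\<lambda>s. - contract u z s) s = contract v (contract u z) s"
          by (simp add: contract_uminus)
        also have "\<dots> = 0"
          using Cons.prems(4) by (auto simp: contract_def supported_def cut_complex_def e)
        finally show ?thesis .
      qed
      then obtain g where g: "supported d (cut_complex es N') g" "\<forall>s. boundary V g s = c2 s"
        using Cons.IH[OF N'(1) es nocp c2] d by auto
      have g0: "g s = 0" if "u \<in> s \<or> v \<in> s" for s
        using g(1) that N' by (auto simp: supported_def cut_complex_def)
      \<comment> \<open>\<open>h\<close> is \<open>u \<and> v \<and> g\<close>. Contracting its boundary with \<open>u\<close> and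
        \<open>v\<close> gives the boundary of \<open>g\<close>, hence the part of \<open>c\<close> to be removed.\<close>
      define h where "h = wedge u (wedge v g)"
      have h: "supported (Suc (Suc d)) (cut_complex es N) h"
        unfolding supported_def
      proof (intro allI impI)
        fix s assume "h s \<noteq> 0"
        hence s: "u \<in> s" "v \<in> s" "g (s - {u} - {v}) \<noteq> 0"
          by (auto simp: h_def wedge_def split: if_splits)
        define t where "t = s - {u} - {v}"
        have t: "s = insert u (insert v t)" "u \<notin> t" "v \<notin> t" using s by (auto simp: t_def)
        have "t \<in> cut_complex es N'" "finite t" "card t = d"
          using g(1) s(3) by (auto simp: supported_def t_def)
        thus "s \<in> cut_complex es N \<and> finite s \<and> card s = Suc (Suc d)"
          using t join[OF t(2,3)] False uv by auto
      qed
      have gc: "contract v (contract u h) = g"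
      proof
        fix s
        show "contract v (contract u h) s = g s"
        proof (cases "u \<in> s \<or> v \<in> s")
          case True
          thus ?thesis using g0[OF True] by (auto simp: contract_def)
        next
          case False
          hence "insert u (insert v s) - {u} = insert v s" "insert v s - {v} = s" using uv by auto
          thus ?thesis using False uv
            by (simp add: contract_def h_def wedge_def shuffle_sign_square' mult.left_commute)
        qed
      qed
      define c' where "c' = (\<lambda>s. c s - boundary V h s)"
      have "contract v (contract u c') s = 0" for s
      proof -
        have "contract u c' = (\<lambda>s. contract u c s + boundary V (contract u h) s)"
          by (rule ext) (simp add: c'_def contract_diff boundary_contract)
        hence "contract v (contract u c') s = c2 s + contract v (boundary V (contract u h)) s"
          by (simp add: contract_add c2_def)
        also have "contract v (boundary V (contract u h)) s = - boundary V g s"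
          using boundary_contract[of V v "contract u h" s] gc by simp
        finally show ?thesis using g(2) by simp
      qed
      hence c'0: "c' s = 0" if "u \<in> s" "v \<in> s" for s
      proof -
        define t where "t = s - {u, v}"
        have t: "s = insert u (insert v t)" "u \<notin> t" "v \<notin> t" using that by (auto simp: t_def)
        have "contract v (contract u c') t = 0" by fact
        thus ?thesis using t uv by (auto simp: contract_def shuffle_sign_def)
      qed
      have "supported (Suc d) (cut_complex es N) (boundary V h)"
        using supported_boundary[OF h, of V] cut_complex_subset[OF _ subset_insertI] by auto
      hence "supported (Suc d) (cut_complex es N) c'"
        using c(1) unfolding supported_def c'_def by force
      hence "supported (Suc d) (cut_complex (e # es) N) c'"
        using c'0 unfolding supported_def by (auto simp: cut_complex_def e)
      moreover have "boundary V c' s = z s" for s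
        using c(2) by (simp add: c'_def boundary_diff boundary_boundary)
      ultimately show ?thesis by blast
    qed
  qed
qed

section \<open>Cycles of simplices with finite edges\<close>

lemma ex_sorted_wrt:
  assumes "finite X" and tot: "\<And>x y. R x y \<or> R y x" and tr: "\<And>x y z. R x y \<Longrightarrow> R y z \<Longrightarrow> R x z"
  shows "\<exists>xs. set xs = X \<and> sorted_wrt R xs"
  using assms(1)
proof (induction X rule: finite_induct)
  case (insert x X)
  then obtain xs where xs: "set xs = X" "sorted_wrt R xs" by auto
  define ys where "ys = filter (\<lambda>y. R y x) xs @ x # filter (\<lambda>y. \<not> R y x) xs"
  have "set ys = insert x X" using xs by (auto simp: ys_def)
  moreover have "sorted_wrt R ys"
    unfolding ys_def sorted_wrt_append sorted_wrt.simps
  proof (intro conjI ballI)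
    show "sorted_wrt R (filter (\<lambda>y. R y x) xs)" "sorted_wrt R (filter (\<lambda>y. \<not> R y x) xs)"
      using xs(2) by (simp_all add: sorted_wrt_filter)
    show above: "R x z" if "z \<in> set (filter (\<lambda>y. \<not> R y x) xs)" for z using that tot[of x z] by simp
    show "R y z" if "y \<in> set (filter (\<lambda>y. R y x) xs)" "z \<in> set (x # filter (\<lambda>y. \<not> R y x) xs)" for y z
      using that tr[of y x z] above by auto
  qed
  ultimately show ?case by blast
qed auto

text \<open>If \<open>R\<close> is the order of the list of deleted edges, this says that all edges of \<open>E\<close> joining the pair \<open>e\<close> to the
pair \<open>f\<close> were deleted no earlier than both of them.\<close>

definition cross_later :: "((nat \<times> nat) \<Rightarrow> (nat \<times> nat) \<Rightarrow> bool) \<Rightarrow> (nat \<times> nat) set \<Rightarrow> nat \<times> nat \<Rightarrow> nat \<times> nat \<Rightarrow> bool" where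
  "cross_later R E e f \<longleftrightarrow> (\<forall>w\<in>{fst e, snd e}. \<forall>w'\<in>{fst f, snd f}. w \<noteq> w' \<and>
     (\<forall>g\<in>{(w, w'), (w', w)}. g \<in> E \<longrightarrow> R g e \<and> R g f))"

lemma cross_later_insert:
  assumes "cross_later R E x y" "R e x" "R e y"
  shows "cross_later R (insert e E) x y"
  unfolding cross_later_def
proof (intro ballI conjI impI)
  fix w w' g assume h: "w \<in> {fst x, snd x}" "w' \<in> {fst y, snd y}"
  show "w \<noteq> w'" using assms(1) h unfolding cross_later_def by blast
  assume g: "g \<in> {(w, w'), (w', w)}" "g \<in> insert e E"
  have "R g x \<and> R g y"
  proof (cases "g = e")
    case True thus ?thesis using assms(2,3) by simp
  next
    case False
    hence "g \<in> E" using g(2) by simp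
    thus ?thesis using assms(1) h g(1) unfolding cross_later_def by blast
  qed
  thus "R g x" "R g y" by auto
qed

lemma cross_polytope_cross_later:
  assumes refl: "\<And>x. R x x"
  shows "cross_polytope ps es N \<Longrightarrow> sorted_wrt R es \<Longrightarrow>
    sorted_wrt (cross_later R (set es)) ps \<and> set ps \<subseteq> set es \<and> (\<forall>e\<in>set ps. fst e \<in> N \<and> snd e \<in> N)"
proof (induction ps es N rule: cross_polytope.induct)
  case (3 p ps e es N)
  have mono: "sorted_wrt (cross_later R (set (e # es))) qs"
    if "sorted_wrt (cross_later R (set es)) qs" "set qs \<subseteq> set es" for qs
  proof (rule sorted_wrt_mono_rel[OF _ that(1)])
    fix x y assume "x \<in> set qs" "y \<in> set qs" "cross_later R (set es) x y"
    moreover have "R e x" "R e y" using that(2) 3(4) calculation(1,2) by auto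
    ultimately show "cross_later R (set (e # es)) x y" by (simp add: cross_later_insert)
  qed
  from 3(3) show ?case unfolding cross_polytope.simps
  proof
    assume "cross_polytope (p # ps) es N"
    from 3(1)[OF this] 3(4) show ?thesis using mono[of "p # ps"] by auto
  next
    assume h: "p = e \<and> fst e \<in> N \<and> snd e \<in> N \<and> cross_polytope ps es (common_link e es N)"
    with 3(2) 3(4) have ih: "sorted_wrt (cross_later R (set es)) ps" "set ps \<subseteq> set es"
       "\<forall>f\<in>set ps. fst f \<in> common_link e es N \<and> snd f \<in> common_link e es N" by auto
    have "cross_later R (set (e # es)) e f" if f: "f \<in> set ps" for f
    proof -
      have "R e f" using ih(2) f 3(4) by auto
      moreover have "cross_later R (set es) e f"
        using ih(3) f unfolding cross_later_def by (cases e) auto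
      ultimately show ?thesis using refl by (simp add: cross_later_insert)
    qed
    moreover have "\<forall>f\<in>set ps. fst f \<in> N \<and> snd f \<in> N" using ih(3) by (cases e) auto
    ultimately show ?thesis using h mono[OF ih(1,2)] ih(2) by auto
  qed
qed auto

text \<open>The order \<open>R\<close> of the deleted edges meets the hypotheses of \<open>matching_dominant_nonsingular\<close>, because a finite
distance is smaller than every infinite one. On the other hand the distances form a matrix of rank at most \<open>m\<close>.\<close>

lemma no_cross_polytope_of_infinite_edges:
  fixes l :: "nat \<Rightarrow> nat \<Rightarrow> 'a::field"
  assumes A: "valuation_ring A"
    and sym: "\<And>u v. l u v = l v u" and diag: "\<And>u. l u u = 0"
    and rank: "\<And>u v. l u v = (\<Sum>j<m. \<phi> u j * \<psi> v j)"
    and es: "set es = {(u, v). u \<in> V \<and> v \<in> V \<and> u < v \<and> l u v \<notin> A}"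
    and R: "R = (\<lambda>e f. vle A (l (fst e) (snd e)) (l (fst f) (snd f)) \<and>
       (vle A (l (fst f) (snd f)) (l (fst e) (snd e)) \<longrightarrow> fst f \<le> fst e))"
    and sorted: "sorted_wrt R es"
    and cp: "cross_polytope ps es V"
  shows "2 * length ps \<le> m"
proof (rule ccontr)
  assume m: "\<not> 2 * length ps \<le> m"
  note subr = val_subring[OF A]
  have "\<And>x. R x x" using vle_refl[OF A] by (simp add: R)
  from cross_polytope_cross_later[OF this cp sorted]
  have so: "sorted_wrt (cross_later R (set es)) ps" and ps: "set ps \<subseteq> set es" by auto
  have later_sym: "cross_later R (set es) e f \<Longrightarrow> cross_later R (set es) f e" for e f
    unfolding cross_later_def by (metis insert_iff)
  have later: "cross_later R (set es) (ps ! i) (ps ! j)" if "i < length ps" "j < length ps" "i \<noteq> j" for i j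
    using sorted_wrt_nth_less[OF so, of i j] sorted_wrt_nth_less[OF so, of j i] that later_sym
    by (cases "i < j") auto
  have irr: "\<not> cross_later R (set es) e e" for e by (auto simp: cross_later_def)
  have dist: "distinct ps" unfolding distinct_conv_nth using later irr by metis
  have cl: "cross_later R (set es) e f" if "e \<in> set ps" "f \<in> set ps" "e \<noteq> f" for e f
    using that later by (metis in_set_conv_nth)
  have P: "u \<in> V \<and> v \<in> V \<and> u < v \<and> l u v \<notin> A" if "(u, v) \<in> set ps" for u v
    using that ps es by auto
  have disj: "{fst e, snd e} \<inter> {fst f, snd f} = {}" if "e \<in> set ps" "f \<in> set ps" "e \<noteq> f" for e f
    using cl[OF that] unfolding cross_later_def by blast
  define S where "S = (\<Union>e\<in>set ps. {fst e, snd e})"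
  have finS: "finite S" by (auto simp: S_def)
  have "card S = (\<Sum>e\<in>set ps. card {fst e, snd e})"
    unfolding S_def by (rule card_UN_disjoint) (use disj in auto)
  also have "\<dots> = (\<Sum>e\<in>set ps. 2)"
  proof (rule sum.cong[OF refl])
    fix e assume "e \<in> set ps"
    hence "fst e < snd e" using P[of "fst e" "snd e"] by simp
    thus "card {fst e, snd e} = 2" by simp
  qed
  finally have cardS: "card S = 2 * length ps" using dist by (simp add: distinct_card)
  define \<pi> where "\<pi> = (\<lambda>w. THE v. (w, v) \<in> set ps \<or> (v, w) \<in> set ps)"
  have \<pi>: "\<pi> u = v \<and> \<pi> v = u" if "(u, v) \<in> set ps" for u v
  proof
    have uniq: "e = (u, v)" if "e \<in> set ps" "w \<in> {fst e, snd e}" "w \<in> {u, v}" for e w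
      using disj[of e "(u, v)"] that \<open>(u, v) \<in> set ps\<close> by auto
    have "u < v" using P that by auto
    show "\<pi> u = v" unfolding \<pi>_def
    proof (rule the_equality)
      fix w assume "(u, w) \<in> set ps \<or> (w, u) \<in> set ps"
      thus "w = v" using uniq[of "(u, w)" u] uniq[of "(w, u)" u] \<open>u < v\<close> by auto
    qed (use that in auto)
    show "\<pi> v = u" unfolding \<pi>_def
    proof (rule the_equality)
      fix w assume "(v, w) \<in> set ps \<or> (w, v) \<in> set ps"
      thus "w = u" using uniq[of "(v, w)" v] uniq[of "(w, v)" v] \<open>u < v\<close> by auto
    qed (use that in auto)
  qed
  obtain c where c: "\<exists>w\<in>S. c w \<noteq> 0" "\<forall>j<m. (\<Sum>w\<in>S. c w * \<phi> w j) = 0"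
    using linear_dependence[OF finS, of m \<phi>] m cardS by auto
  have ker: "(\<Sum>w\<in>S. c w * l w w') = 0" for w'
  proof -
    have "(\<Sum>w\<in>S. c w * l w w') = (\<Sum>w\<in>S. \<Sum>j<m. c w * \<phi> w j * \<psi> w' j)"
      by (simp add: rank sum_distrib_left mult.assoc)
    also have "\<dots> = (\<Sum>j<m. (\<Sum>w\<in>S. c w * \<phi> w j) * \<psi> w' j)"
      by (subst sum.swap) (simp add: sum_distrib_right)
    also have "\<dots> = 0" using c(2) by simp
    finally show ?thesis .
  qed
  have pair: "\<exists>e\<in>set ps. w \<in> {fst e, snd e} \<and> {w, \<pi> w} = {fst e, snd e} \<and> min w (\<pi> w) = fst e \<and>
      l w (\<pi> w) = l (fst e) (snd e) \<and> \<pi> w \<noteq> w \<and> \<pi> (\<pi> w) = w" if "w \<in> S" for w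
  proof -
    from that obtain u v where e: "(u, v) \<in> set ps" "w = u \<or> w = v" by (auto simp: S_def)
    show ?thesis using e \<pi>[OF e(1)] P[OF e(1)] sym
      by (intro bexI[OF _ e(1)]) auto
  qed
  have "c w = 0" if "w \<in> S" for w
  proof (rule matching_dominant_nonsingular[OF A finS sym diag _ _ ker that])
    fix w assume "w \<in> S"
    from pair[OF this] obtain e where e: "e \<in> set ps" "{w, \<pi> w} = {fst e, snd e}"
      "l w (\<pi> w) = l (fst e) (snd e)" "\<pi> w \<noteq> w" "\<pi> (\<pi> w) = w" by blast
    have "\<pi> w \<in> S" using e(1,2) by (auto simp: S_def)
    moreover have "l (fst e) (snd e) \<notin> A" using P[of "fst e" "snd e"] e(1) by simp
    ultimately show "\<pi> w \<in> S \<and> \<pi> (\<pi> w) = w \<and> \<pi> w \<noteq> w \<and> l w (\<pi> w) \<noteq> 0"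
      using e subring_0[OF subr] by auto
  next
    fix w w' assume w: "w \<in> S" "w' \<in> S" "w' \<noteq> w" "w' \<noteq> \<pi> w"
    from pair[OF w(1)] obtain e where e: "e \<in> set ps" "w \<in> {fst e, snd e}" "{w, \<pi> w} = {fst e, snd e}" by blast
    from pair[OF w(2)] obtain f where f: "f \<in> set ps" "w' \<in> {fst f, snd f}"
       "min w' (\<pi> w') = fst f" "l w' (\<pi> w') = l (fst f) (snd f)" by blast
    have "e \<noteq> f" using e f w by auto
    from cl[OF e(1) f(1) this] e(2) f(2)
    have g: "g \<in> set es \<Longrightarrow> R g f" if "g = (w, w') \<or> g = (w', w)" for g
      using that unfolding cross_later_def by blast
    define g where "g = (min w w', max w w')"
    have g': "g = (w, w') \<or> g = (w', w)" by (auto simp: g_def min_def max_def)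
    have lg: "l w w' = l (fst g) (snd g)" using g' sym by auto
    have gV: "fst g \<in> V" "snd g \<in> V" "fst g < snd g"
      using e f P[of "fst e" "snd e"] P[of "fst f" "snd f"] w(3) by (auto simp: g_def min_def max_def)
    have lf: "l (fst f) (snd f) \<notin> A" using P[of "fst f" "snd f"] f(1) by simp
    have "R g f"
    proof (cases "g \<in> set es")
      case True thus ?thesis using g[OF g'] by blast
    next
      case False
      hence "l (fst g) (snd g) \<in> A" using gV es by (cases g) auto
      hence "\<not> vle A (l (fst f) (snd f)) (l (fst g) (snd g))" using lf vle_in[OF A] by blast
      thus ?thesis using vle_total[OF A] by (auto simp: R)
    qed
    thus "vle A (l w w') (l w' (\<pi> w')) \<and>
       (vle A (l w' (\<pi> w')) (l w w') \<longrightarrow> min w' (\<pi> w') \<le> min w w')"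
      unfolding f(3,4) lg R by (simp add: g_def)
  qed
  thus False using c(1) by blast
qed

text \<open>Infinite distances are deleted in the order of decreasing absolute value, and among equal absolute values in the order of
increasing least endpoint.\<close>

lemma finite_distance_cycles_bound:
  fixes l :: "nat \<Rightarrow> nat \<Rightarrow> 'a::field"
  assumes A: "valuation_ring A" and V: "finite V"
    and sym: "\<And>u v. l u v = l v u" and diag: "\<And>u. l u u = 0"
    and rank: "\<And>u v. l u v = (\<Sum>j<m. \<phi> u j * \<psi> v j)" and m: "m < 2 * d"
    and X: "X = {s. s \<subseteq> V \<and> (\<forall>u\<in>s. \<forall>v\<in>s. l u v \<in> A)}"
    and z: "supported d X z" "\<forall>s. boundary V z s = 0"
  shows "\<exists>c. supported (Suc d) X c \<and> (\<forall>s. boundary V c s = z s)"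
proof -
  define R where "R = (\<lambda>e f. vle A (l (fst e) (snd e)) (l (fst f) (snd f)) \<and>
       (vle A (l (fst f) (snd f)) (l (fst e) (snd e)) \<longrightarrow> fst f \<le> fst e))"
  have "finite {(u, v). u \<in> V \<and> v \<in> V \<and> u < v \<and> l u v \<notin> A}"
    by (rule finite_subset[of _ "V \<times> V"]) (use V in auto)
  moreover have "R x y \<or> R y x" for x y using vle_total[OF A] by (auto simp: R_def)
  moreover have "R x z" if "R x y" "R y z" for x y z
    using that vle_trans[OF A] unfolding R_def by (meson order_trans)
  ultimately have "\<exists>es. set es = {(u, v). u \<in> V \<and> v \<in> V \<and> u < v \<and> l u v \<notin> A} \<and> sorted_wrt R es"
    by (rule ex_sorted_wrt)
  then obtain es where es: "set es = {(u, v). u \<in> V \<and> v \<in> V \<and> u < v \<and> l u v \<notin> A}" "sorted_wrt R es"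
    by blast
  have "\<not> (\<exists>ps. length ps = d \<and> cross_polytope ps es V)"
    using no_cross_polytope_of_infinite_edges[OF A sym diag rank es(1) R_def es(2)] m by fastforce
  moreover have "cut_complex es V = X"
  proof -
    have "l u v \<in> A" if "s \<in> cut_complex es V" "u \<in> s" "v \<in> s" for s u v
    proof -
      have "u \<in> V" "v \<in> V" "(u, v) \<notin> set es" "(v, u) \<notin> set es"
        using that by (auto simp: cut_complex_def)
      hence "u < v \<Longrightarrow> l u v \<in> A" "v < u \<Longrightarrow> l v u \<in> A" unfolding es(1) by auto
      moreover have "l u u \<in> A" using diag subring_0[OF val_subring[OF A]] by simp
      ultimately show ?thesis using sym by (metis linorder_neqE_nat)
    qed
    hence "cut_complex es V \<subseteq> X" by (auto simp: X cut_complex_def)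
    moreover have "X \<subseteq> cut_complex es V"
      unfolding X cut_complex_def es(1) by auto
    ultimately show ?thesis by (rule subset_antisym)
  qed
  ultimately show ?thesis
    using cycle_bounds_unless_cross_polytope[OF V, of V es d z] es(1) z by auto
qed

section \<open>Alternating functions on oriented simplices\<close>

definition alternating :: "('a list \<Rightarrow> real) \<Rightarrow> bool" where
  "alternating g \<longleftrightarrow> (\<forall>xs y z ys. g (xs @ y # z # ys) = - g (xs @ z # y # ys))"

text \<open>The linear extension of \<open>g\<close> to chains; for an alternating \<open>g\<close> it has the value \<open>g xs\<close> on the simplex
oriented by the list \<open>xs\<close>, whatever the order of the list.\<close>

definition pairing :: "nat set \<Rightarrow> (nat list \<Rightarrow> real) \<Rightarrow> chain \<Rightarrow> real" where
  "pairing V g c = (\<Sum>s\<in>Pow V. of_int (c s) * g (sorted_list_of_set s))"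

definition oriented_simplex :: "nat list \<Rightarrow> chain" where
  "oriented_simplex xs = foldr wedge xs (\<lambda>s. if s = {} then 1 else 0)"

text \<open>The front element is moved to its place by adjacent transpositions, one for every smaller element; if it meets
its own copy, alternation makes the value vanish.\<close>

lemma alternating_insort:
  assumes g: "alternating g"
  shows "sorted ys \<Longrightarrow> distinct ys \<Longrightarrow> g (pre @ x # ys) =
    (if x \<in> set ys then 0 else of_int (shuffle_sign x (set ys)) * g (pre @ insort x ys))"
proof (induction ys arbitrary: pre)
  case Nil
  thus ?case by (simp add: shuffle_sign_def)
next
  case (Cons y ys)
  have swap: "g (pre @ x # y # ys) = - g (pre @ y # x # ys)" using g unfolding alternating_def by blast
  show ?case
  proof (cases x y rule: linorder_cases)
    case less
    hence none: "{u \<in> set (y # ys). u < x} = {}" using Cons.prems(1) by auto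
    hence "shuffle_sign x (set (y # ys)) = 1" unfolding shuffle_sign_def by (simp only: none) simp
    thus ?thesis using less none Cons.prems by auto
  next
    case equal
    thus ?thesis using swap by simp
  next
    case greater
    have "g (pre @ y # x # ys) = g ((pre @ [y]) @ x # ys)" by simp
    also have "\<dots> = (if x \<in> set ys then 0 else of_int (shuffle_sign x (set ys)) * g ((pre @ [y]) @ insort x ys))"
      using Cons by (intro Cons.IH) auto
    finally show ?thesis using swap greater Cons.prems(2) by (auto simp: shuffle_sign_insert)
  qed
qed

lemma pairing_wedge:
  assumes V: "finite V" "x \<in> V" and g: "alternating g"
  shows "pairing V g (wedge x c) = pairing V (\<lambda>ys. g (x # ys)) c"
proof -
  have insert_front: "g (x # sorted_list_of_set t) =
      (if x \<in> t then 0 else of_int (shuffle_sign x t) * g (sorted_list_of_set (insert x t)))"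
    if "t \<in> Pow V" for t
  proof -
    have "finite t" using that V finite_subset by blast
    thus ?thesis using alternating_insort[OF g, of "sorted_list_of_set t" "[]" x]
      by (auto simp: sorted_list_of_set_insert_remove)
  qed
  have "pairing V g (wedge x c) = (\<Sum>s\<in>{s\<in>Pow V. x \<in> s}. of_int (wedge x c s) * g (sorted_list_of_set s))"
    unfolding pairing_def by (rule sum.mono_neutral_right) (use V in \<open>auto simp: wedge_def\<close>)
  also have "\<dots> = (\<Sum>t\<in>{t\<in>Pow V. x \<notin> t}. of_int (c t) * g (x # sorted_list_of_set t))"
  proof (rule sum.reindex_bij_witness[of _ "insert x" "\<lambda>s. s - {x}"])
    fix s assume s: "s \<in> {s \<in> Pow V. x \<in> s}"
    hence "insert x (s - {x}) = s" by auto
    thus "of_int (c (s - {x})) * g (x # sorted_list_of_set (s - {x})) =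
        of_int (wedge x c s) * g (sorted_list_of_set s)"
      using insert_front[of "s - {x}"] s by (auto simp: wedge_def)
  qed (use V in auto)
  also have "\<dots> = pairing V (\<lambda>ys. g (x # ys)) c"
    unfolding pairing_def by (rule sum.mono_neutral_left) (use V insert_front in auto)
  finally show ?thesis .
qed

lemma pairing_oriented_simplex:
  assumes V: "finite V"
  shows "set xs \<subseteq> V \<Longrightarrow> alternating g \<Longrightarrow> pairing V g (oriented_simplex xs) = g xs"
proof (induction xs arbitrary: g)
  case Nil
  have "pairing V g (oriented_simplex []) = (\<Sum>s\<in>{{}}. of_int (if s = {} then 1 else 0) * g (sorted_list_of_set s))"
    unfolding pairing_def oriented_simplex_def foldr.simps id_apply
    by (rule sum.mono_neutral_right) (use V in auto)
  thus ?case by simp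
next
  case (Cons x xs)
  have "alternating (\<lambda>ys. g (x # ys))"
    using Cons.prems(2) unfolding alternating_def by (metis append_Cons)
  thus ?case using pairing_wedge[OF V _ Cons.prems(2), of x] Cons by (simp add: oriented_simplex_def)
qed

lemma oriented_simplex_support: "oriented_simplex xs s \<noteq> 0 \<Longrightarrow> s = set xs \<and> distinct xs"
proof (induction xs arbitrary: s)
  case (Cons x xs)
  hence "x \<in> s" "oriented_simplex xs (s - {x}) \<noteq> 0"
    by (auto simp: oriented_simplex_def wedge_def split: if_splits)
  thus ?case using Cons.IH[of "s - {x}"] by auto
qed (auto simp: oriented_simplex_def split: if_splits)

lemma oriented_simplex_swap:
  "oriented_simplex (x # y # xs) s = - oriented_simplex (y # x # xs) s"
  unfolding oriented_simplex_def by (simp add: wedge_anticommute[of x y])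

definition det_of_list :: "nat \<Rightarrow> ('a \<Rightarrow> real vec) \<Rightarrow> 'a list \<Rightarrow> real" where
  "det_of_list n h ys = det (mat_of_cols n (map h ys))"

lemma alternating_det: "alternating (det_of_list n h)"
  unfolding alternating_def
proof (intro allI)
  fix xs y z ys
  show "det_of_list n h (xs @ y # z # ys) = - det_of_list n h (xs @ z # y # ys)"
  proof (cases "length (xs @ y # z # ys) = n")
    case True
    define k where "k = length xs"
    have "mat_of_cols n (map h (xs @ y # z # ys)) =
        swapcols k (Suc k) (mat_of_cols n (map h (xs @ z # y # ys)))"
      by (rule eq_matI) (use True in \<open>auto simp: mat_of_cols_index k_def nth_append nth_Cons' nth_Cons split: nat.splits\<close>)
    moreover have "mat_of_cols n (map h (xs @ z # y # ys)) \<in> carrier_mat n n"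
      using True by (intro carrier_matI) simp_all
    moreover have "k < n" "Suc k < n" using True by (simp_all add: k_def)
    ultimately show ?thesis
      unfolding det_of_list_def using det_swapcols[of k n "Suc k"] by simp
  next
    case False
    \<comment> \<open>For lists of another length the matrix is not square, and \<open>det\<close> is \<open>0\<close> by
      convention.\<close>
    thus ?thesis by (auto simp: det_of_list_def det_def)
  qed
qed

lemma det_of_list_permute:
  assumes p: "p permutes {..<length xs}" and n: "length xs = n"
  shows "det_of_list n h (permute_list p xs) = of_int (sign p) * det_of_list n h xs"
proof -
  let ?A = "mat_of_rows n (map h xs)"
  have A: "?A \<in> carrier_mat n n" using n by (intro carrier_matI) simp_all
  have tr: "det_of_list n h ys = det (mat_of_rows n (map h ys))" if "length ys = n" for ys
    unfolding det_of_list_def transpose_mat_of_rows[symmetric]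
    by (rule det_transpose, rule carrier_matI) (use that in simp_all)
  have "mat_of_rows n (map h (permute_list p xs)) = mat n n (\<lambda>(i, j). ?A $$ (p i, j))"
  proof (rule eq_matI)
    fix i j assume ij: "i < dim_row (mat n n (\<lambda>(i, j). ?A $$ (p i, j)))" "j < dim_col (mat n n (\<lambda>(i, j). ?A $$ (p i, j)))"
    hence "p i < n" using permutes_in_image[OF p, of i] n by simp
    thus "mat_of_rows n (map h (permute_list p xs)) $$ (i, j) = mat n n (\<lambda>(i, j). ?A $$ (p i, j)) $$ (i, j)"
      using ij n p by (simp add: mat_of_rows_index permute_list_nth)
  qed (use n in auto)
  thus ?thesis using det_permute_rows[OF A, of p] p n tr[of xs] tr[of "permute_list p xs"]
    by (simp add: atLeast0LessThan)
qed

text \<open>An alternating function with value \<open>1\<close> on the sorted list detects the sign of an oriented simplex.\<close>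

lemma oriented_simplex_coefficient:
  assumes "distinct xs" "alternating g"
  shows "of_int (oriented_simplex xs (set xs)) * g (sorted_list_of_set (set xs)) = g xs"
proof -
  have "pairing (set xs) g (oriented_simplex xs) =
      (\<Sum>s\<in>{set xs}. of_int (oriented_simplex xs s) * g (sorted_list_of_set s))"
    unfolding pairing_def by (rule sum.mono_neutral_right) (use oriented_simplex_support in auto)
  thus ?thesis using pairing_oriented_simplex[of "set xs" xs g] assms by simp
qed

text \<open>The determinant whose columns are the unit vectors of the vertices is the detecting function here, so the
sign rule is inherited from determinants.\<close>

lemma oriented_simplex_permute:
  assumes d: "distinct xs" and p: "p permutes {..<length xs}"
  shows "oriented_simplex (permute_list p xs) s = sign p * oriented_simplex xs s"
proof (cases "s = set xs")
  case True
  define n where "n = length xs"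
  define L where "L = sorted_list_of_set (set xs)"
  have L: "distinct L" "length L = n" "set L = set xs"
    using d by (simp_all add: L_def n_def distinct_card)
  define h where "h = (\<lambda>w. vec n (\<lambda>i. if L ! i = w then 1 else 0) :: real vec)"
  have "mat_of_cols n (map h L) = 1\<^sub>m n"
    by (rule eq_matI) (use L in \<open>auto simp: mat_of_cols_index h_def nth_eq_iff_index_eq\<close>)
  hence one: "det_of_list n h L = 1" by (simp add: det_of_list_def)
  have "set (permute_list p xs) = set xs" "distinct (permute_list p xs)" using p d by auto
  from oriented_simplex_coefficient[OF this(2) alternating_det, of n h] this(1)
    oriented_simplex_coefficient[OF d alternating_det, of n h]
    det_of_list_permute[OF p, of n h]
  have "real_of_int (oriented_simplex (permute_list p xs) (set xs)) =
      real_of_int (sign p * oriented_simplex xs (set xs))"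
    using one unfolding L_def n_def by (metis mult.right_neutral of_int_mult)
  thus ?thesis using True of_int_eq_iff by blast
next
  case False
  hence "oriented_simplex xs s = 0" "oriented_simplex (permute_list p xs) s = 0"
    using oriented_simplex_support[of xs s] oriented_simplex_support[of "permute_list p xs" s] p by auto
  thus ?thesis by simp
qed

lemma orientation_simplex_unique:
  assumes o: "simplex_orientation \<sigma> A" and f: "inj_on f \<sigma>" and "xs \<in> A" "ys \<in> A"
  shows "oriented_simplex (map f xs) = oriented_simplex (map f ys)"
proof -
  from o obtain ws where ws: "distinct ws" "set ws = \<sigma>"
    "A = {permute_list p ws | p. p permutes {..<length ws} \<and> evenperm p}"
    by (auto simp: simplex_orientation_def)
  have "oriented_simplex (map f zs) = oriented_simplex (map f ws)" if "zs \<in> A" for zs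
  proof
    fix s
    from that ws obtain p where p: "p permutes {..<length ws}" "evenperm p" "zs = permute_list p ws" by auto
    have "map f zs = permute_list p (map f ws)" using p by (simp add: permute_list_map)
    thus "oriented_simplex (map f zs) s = oriented_simplex (map f ws) s"
      using oriented_simplex_permute[of "map f ws" p s] p ws f by (simp add: distinct_map sign_def)
  qed
  thus ?thesis using assms by simp
qed

text \<open>The two lists differ by a transposition, and an orientation consists of one parity class of orderings.\<close>

lemma orientation_contains_one_of:
  assumes o: "simplex_orientation (insert u \<rho>) A" and u: "u \<notin> \<rho>"
    and vs: "distinct (x # y # vs)" "set (x # y # vs) = \<rho>"
  shows "u # x # y # vs \<in> A \<or> u # y # x # vs \<in> A"
proof -
  from o obtain ws where ws: "distinct ws" "set ws = insert u \<rho>"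
    "A = {permute_list p ws | p. p permutes {..<length ws} \<and> evenperm p}"
    by (auto simp: simplex_orientation_def)
  have "mset ws = mset (u # x # y # vs)"
    using ws u vs by (intro set_eq_iff_mset_eq_distinct[THEN iffD1]) auto
  then obtain p where p: "p permutes {..<length ws}" "permute_list p ws = u # x # y # vs"
    by (metis mset_eq_permutation)
  show ?thesis
  proof (cases "evenperm p")
    case True thus ?thesis using p ws(3) by auto
  next
    case False
    define q where "q = transpose (1::nat) 2"
    have len: "length ws = Suc (Suc (Suc (length vs)))" using p(2) by (metis length_permute_list length_Cons)
    have q: "q permutes {..<length ws}" unfolding q_def by (rule permutes_swap_id) (use len in auto)
    have "permute_list (p \<circ> q) ws = permute_list q (permute_list p ws)" by (rule permute_list_compose[OF q])
    also have "\<dots> = u # y # x # vs"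
      unfolding p(2)
    proof (rule nth_equalityI)
      fix i assume "i < length (permute_list q (u # x # y # vs))"
      hence i: "i < length ws" using len by simp
      have "permute_list q (u # x # y # vs) ! i = (u # x # y # vs) ! (q i)"
        by (rule permute_list_nth) (use q i len in auto)
      also have "\<dots> = (u # y # x # vs) ! i"
        by (auto simp: q_def transpose_def nth_Cons' numeral_2_eq_2)
      finally show "permute_list q (u # x # y # vs) ! i = (u # y # x # vs) ! i" .
    qed simp
    finally have "permute_list (p \<circ> q) ws = u # y # x # vs" .
    moreover have "p \<circ> q permutes {..<length ws}" using p(1) q by (rule permutes_compose[rotated])
    moreover have "evenperm (p \<circ> q)"
    proof -
      have "permutation p" "permutation q" using p(1) q permutation_permutes by blast+
      moreover have "\<not> evenperm q" by (simp add: q_def evenperm_swap)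
      ultimately show ?thesis using False by (simp add: evenperm_comp)
    qed
    ultimately have "u # y # x # vs \<in> A" unfolding ws(3) by (metis (mono_tags, lifting) mem_Collect_eq)
    thus ?thesis ..
  qed
qed

section \<open>Volume of a boundary\<close>

text \<open>The pairing moves the boundary operator from the chain to the function.\<close>

lemma pairing_boundary:
  assumes V: "finite V"
  shows "pairing V g (boundary V c) = (\<Sum>t\<in>Pow V. of_int (c t) *
    (\<Sum>v\<in>t. of_int (shuffle_sign v (t - {v})) * g (sorted_list_of_set (t - {v}))))"
proof -
  let ?G = "\<lambda>s. g (sorted_list_of_set s)"
  have "pairing V g (boundary V c) =
     (\<Sum>s\<in>Pow V. \<Sum>v\<in>V. of_int (contract v c s) * ?G s)"
    by (simp add: pairing_def boundary_def sum_distrib_right)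
  also have "\<dots> = (\<Sum>v\<in>V. \<Sum>s\<in>Pow V. of_int (contract v c s) * ?G s)" by (rule sum.swap)
  also have "\<dots> = (\<Sum>v\<in>V. \<Sum>t\<in>Pow V. if v \<in> t then of_int (c t) * (of_int (shuffle_sign v (t - {v})) * ?G (t - {v})) else 0)"
  proof (rule sum.cong[OF refl])
    fix v assume v: "v \<in> V"
    have "(\<Sum>s\<in>Pow V. of_int (contract v c s) * ?G s) = (\<Sum>s\<in>{s\<in>Pow V. v \<notin> s}. of_int (contract v c s) * ?G s)"
      by (rule sum.mono_neutral_right) (use V in \<open>auto simp: contract_def\<close>)
    also have "\<dots> = (\<Sum>t\<in>{t\<in>Pow V. v \<in> t}. of_int (c t) * (of_int (shuffle_sign v (t - {v})) * ?G (t - {v})))"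
      by (rule sum.reindex_bij_witness[of _ "\<lambda>t. t - {v}" "insert v"])
         (use v in \<open>auto simp: contract_def insert_absorb\<close>)
    also have "\<dots> = (\<Sum>t\<in>Pow V. if v \<in> t then of_int (c t) * (of_int (shuffle_sign v (t - {v})) * ?G (t - {v})) else 0)"
      by (rule sum.mono_neutral_cong_left) (use V in auto)
    finally show "(\<Sum>s\<in>Pow V. of_int (contract v c s) * ?G s) = \<dots>" .
  qed
  also have "\<dots> = (\<Sum>t\<in>Pow V. \<Sum>v\<in>V. if v \<in> t then of_int (c t) * (of_int (shuffle_sign v (t - {v})) * ?G (t - {v})) else 0)"
    by (rule sum.swap)
  also have "\<dots> = (\<Sum>t\<in>Pow V. of_int (c t) * (\<Sum>v\<in>t. of_int (shuffle_sign v (t - {v})) * ?G (t - {v})))"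
  proof (rule sum.cong[OF refl])
    fix t assume t: "t \<in> Pow V"
    have "(\<Sum>v\<in>V. if v \<in> t then of_int (c t) * (of_int (shuffle_sign v (t - {v})) * ?G (t - {v})) else 0)
      = (\<Sum>v\<in>t. of_int (c t) * (of_int (shuffle_sign v (t - {v})) * ?G (t - {v})))"
      by (rule sum.mono_neutral_cong_right) (use V t in auto)
    thus "(\<Sum>v\<in>V. if v \<in> t then of_int (c t) * (of_int (shuffle_sign v (t - {v})) * ?G (t - {v})) else 0)
      = of_int (c t) * (\<Sum>v\<in>t. of_int (shuffle_sign v (t - {v})) * ?G (t - {v}))"
      by (simp add: sum_distrib_left)
  qed
  finally show ?thesis .
qed

text \<open>The columns are \<open>(1, x - q)\<close> for the points \<open>x\<close> listed in \<open>L\<close>.\<close>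

definition homogeneous_matrix :: "nat \<Rightarrow> (nat \<Rightarrow> nat \<Rightarrow> real) \<Rightarrow> (nat \<Rightarrow> real) \<Rightarrow> nat list \<Rightarrow> real mat" where
  "homogeneous_matrix n x q L = mat (Suc n) (Suc n) (\<lambda>(i, j). case i of 0 \<Rightarrow> 1 | Suc k \<Rightarrow> x (L ! j) k - q k)"

text \<open>Changing the base point adds multiples of the row of ones to the other rows.\<close>

lemma det_homogeneous_matrix_base_point:
  "det (homogeneous_matrix n x q L) = det (homogeneous_matrix n x q' L)"
proof -
  define T where "T = mat (Suc n) (Suc n) (\<lambda>(i, k). if i = k then 1 else if k = 0 then q' (i - 1) - q (i - 1) else (0::real))"
  have T: "T \<in> carrier_mat (Suc n) (Suc n)" by (simp add: T_def)
  have M: "homogeneous_matrix n x q' L \<in> carrier_mat (Suc n) (Suc n)" by (simp add: homogeneous_matrix_def)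
  have "det T = prod_list (diag_mat T)"
    by (rule det_lower_triangular[OF _ T]) (auto simp: T_def)
  also have "diag_mat T = replicate (Suc n) 1"
    by (rule nth_equalityI) (auto simp: diag_mat_def T_def simp del: upt_Suc replicate_Suc)
  finally have dT: "det T = 1" by simp
  have "homogeneous_matrix n x q L = T * homogeneous_matrix n x q' L"
  proof (rule eq_matI)
    fix i j assume "i < dim_row (T * homogeneous_matrix n x q' L)" "j < dim_col (T * homogeneous_matrix n x q' L)"
    hence ij: "i < Suc n" "j < Suc n" by (auto simp: T_def homogeneous_matrix_def)
    have "(T * homogeneous_matrix n x q' L) $$ (i, j) =
        (\<Sum>k<Suc n. T $$ (i, k) * homogeneous_matrix n x q' L $$ (k, j))"
      using ij T M by (simp add: scalar_prod_def atLeast0LessThan)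
    also have "\<dots> = T $$ (i, 0) * homogeneous_matrix n x q' L $$ (0, j) +
        (\<Sum>k<n. T $$ (i, Suc k) * homogeneous_matrix n x q' L $$ (Suc k, j))"
      by (rule sum.lessThan_Suc_shift)
    also have "\<dots> = T $$ (i, 0) + (\<Sum>k<n. if i = Suc k then x (L ! j) k - q' k else 0)"
      using ij by (auto simp: T_def homogeneous_matrix_def intro!: sum.cong)
    also have "\<dots> = homogeneous_matrix n x q L $$ (i, j)"
      using ij by (cases i) (auto simp: T_def homogeneous_matrix_def)
    finally show "homogeneous_matrix n x q L $$ (i, j) = (T * homogeneous_matrix n x q' L) $$ (i, j)" ..
  qed (auto simp: T_def homogeneous_matrix_def)
  thus ?thesis using det_mult[OF T M] dT by simp
qed

lemma mat_delete_homogeneous_matrix: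
  assumes "length L = Suc n" "j < Suc n"
  shows "mat_delete (homogeneous_matrix n x q L) 0 j =
     mat_of_cols n (map (\<lambda>w. vec n (\<lambda>i. x w i - q i)) (take j L @ drop (Suc j) L))"
  by (rule eq_matI)
     (use assms in \<open>auto simp: mat_delete_def homogeneous_matrix_def mat_of_cols_index nth_append min_def\<close>)

lemma det_homogeneous_matrix_row:
  assumes "length L = Suc n"
  shows "det (homogeneous_matrix n x q L) = (\<Sum>j<Suc n. (- 1) ^ j *
     det_of_list n (\<lambda>w. vec n (\<lambda>i. x w i - q i)) (take j L @ drop (Suc j) L))"
proof -
  have M: "homogeneous_matrix n x q L \<in> carrier_mat (Suc n) (Suc n)" by (simp add: homogeneous_matrix_def)
  show ?thesis
    unfolding laplace_expansion_row[OF M zero_less_Suc]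
  proof (rule sum.cong[OF refl])
    fix j assume "j \<in> {..<Suc n}"
    hence j: "j < Suc n" by simp
    have "homogeneous_matrix n x q L $$ (0, j) = 1" using j by (simp add: homogeneous_matrix_def)
    thus "homogeneous_matrix n x q L $$ (0, j) * cofactor (homogeneous_matrix n x q L) 0 j =
        (- 1) ^ j * det_of_list n (\<lambda>w. vec n (\<lambda>i. x w i - q i)) (take j L @ drop (Suc j) L)"
      unfolding cofactor_def mat_delete_homogeneous_matrix[OF assms j] det_of_list_def by simp
  qed
qed

lemma det_homogeneous_matrix_column:
  assumes L: "length L = Suc n"
  shows "det (homogeneous_matrix n x q L) =
     det (mat n n (\<lambda>(i, j). x (L ! Suc j) i - x (L ! 0) i))"
proof -
  let ?M = "homogeneous_matrix n x (x (L ! 0)) L"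
  have M: "?M \<in> carrier_mat (Suc n) (Suc n)" by (simp add: homogeneous_matrix_def)
  have "det ?M = (\<Sum>i<Suc n. ?M $$ (i, 0) * cofactor ?M i 0)" by (rule laplace_expansion_column[OF M zero_less_Suc])
  also have "\<dots> = ?M $$ (0, 0) * cofactor ?M 0 0 + (\<Sum>i<n. ?M $$ (Suc i, 0) * cofactor ?M (Suc i) 0)"
    by (rule sum.lessThan_Suc_shift)
  also have "\<dots> = det (mat_delete ?M 0 0)" by (simp add: homogeneous_matrix_def cofactor_def)
  also have "mat_delete ?M 0 0 = mat n n (\<lambda>(i, j). x (L ! Suc j) i - x (L ! 0) i)"
    by (rule eq_matI) (auto simp: mat_delete_def homogeneous_matrix_def)
  finally show ?thesis using det_homogeneous_matrix_base_point by metis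
qed

lemma sorted_list_of_set_remove_nth:
  assumes t: "finite t" and j: "j < card t"
  defines "L \<equiv> sorted_list_of_set t"
  shows "sorted_list_of_set (t - {L ! j}) = take j L @ drop (Suc j) L"
    and "shuffle_sign (L ! j) (t - {L ! j}) = (- 1) ^ j"
proof -
  have L: "sorted L" "distinct L" "set L = t" "length L = card t"
    using t by (simp_all add: L_def)
  have split: "L = take j L @ L ! j # drop (Suc j) L" using j L(4) by (simp add: id_take_nth_drop)
  have "sorted (take j L @ L ! j # drop (Suc j) L)" "distinct (take j L @ L ! j # drop (Suc j) L)"
    using L(1,2) split by auto
  hence s: "sorted (take j L @ drop (Suc j) L)" "distinct (take j L @ drop (Suc j) L)"
    "\<forall>u\<in>set (take j L). u < L ! j" "\<forall>u\<in>set (drop (Suc j) L). L ! j < u"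
    by (auto simp: sorted_append order_less_le)
  have tt: "t = set (take j L) \<union> {L ! j} \<union> set (drop (Suc j) L)"
    using L(3) split by (metis Un_insert_right list.simps(15) set_append sup_bot_right Un_insert_left)
  hence rest: "t - {L ! j} = set (take j L @ drop (Suc j) L)"
    using s(3,4) by auto
  show "sorted_list_of_set (t - {L ! j}) = take j L @ drop (Suc j) L"
    unfolding rest using s by (metis sorted_list_of_set.idem_if_sorted_distinct)
  have "{u \<in> t - {L ! j}. u < L ! j} = set (take j L)" using tt s(3,4) by auto
  moreover have "card (set (take j L)) = j" using L(2,4) j by (simp add: distinct_card)
  ultimately show "shuffle_sign (L ! j) (t - {L ! j}) = (- 1) ^ j" by (simp add: shuffle_sign_def)
qed

text \<open>The cone volumes over the facets of a simplex add up to the volume of the simplex, for any apex \<open>q\<close>: they are the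
terms of the expansion of the homogeneous determinant along its row of ones. With the apex at the first
vertex, expansion along the first column leaves the determinant of the edge vectors.\<close>

lemma boundary_volume_of_simplex:
  assumes t: "finite t" "card t = Suc n"
  defines "L \<equiv> sorted_list_of_set t"
  shows "(\<Sum>v\<in>t. of_int (shuffle_sign v (t - {v})) *
       det_of_list n (\<lambda>w. vec n (\<lambda>i. x w i - q i)) (sorted_list_of_set (t - {v}))) =
     det (mat n n (\<lambda>(i, j). x (L ! Suc j) i - x (L ! 0) i))"
proof -
  have L: "length L = Suc n" "distinct L" "set L = t" using t by (simp_all add: L_def)
  have b: "bij_betw ((!) L) {..<Suc n} t"
    using bij_betw_nth[OF L(2), of "{..<Suc n}" t] L by simp
  have "(\<Sum>v\<in>t. of_int (shuffle_sign v (t - {v})) *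
       det_of_list n (\<lambda>w. vec n (\<lambda>i. x w i - q i)) (sorted_list_of_set (t - {v}))) =
     (\<Sum>j<Suc n. of_int (shuffle_sign (L ! j) (t - {L ! j})) *
       det_of_list n (\<lambda>w. vec n (\<lambda>i. x w i - q i)) (sorted_list_of_set (t - {L ! j})))"
    by (rule sum.reindex_bij_betw[OF b, symmetric])
  also have "\<dots> = det (homogeneous_matrix n x q L)"
    unfolding det_homogeneous_matrix_row[OF L(1)]
    by (rule sum.cong[OF refl])
       (use sorted_list_of_set_remove_nth[OF t(1)] t(2) in \<open>simp add: L_def\<close>)
  finally show ?thesis using det_homogeneous_matrix_column[OF L(1)] by simp
qed

section \<open>Integrality of the volume\<close>

lemma prod_cong_mod_2:
  assumes A: "subring A" and "\<And>i. i \<in> I \<Longrightarrow> f i \<in> A \<and> g i \<in> A \<and> (\<exists>a\<in>A. f i - g i = 2 * a)"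
  shows "\<exists>a\<in>A. prod f I - prod g I = (2 :: 'a::comm_ring_1) * a"
  using assms(2)
proof (induction I rule: infinite_finite_induct)
  case (insert i I)
  from insert.prems[of i] obtain a where a: "a \<in> A" "f i - g i = 2 * a" by auto
  from insert.IH insert.prems obtain b where b: "b \<in> A" "prod f I - prod g I = 2 * b" by auto
  have "f i * prod f I - g i * prod g I = (f i - g i) * prod f I + g i * (prod f I - prod g I)"
    by (simp add: algebra_simps)
  also have "\<dots> = 2 * (a * prod f I + g i * b)" unfolding a b by (simp add: algebra_simps)
  finally show ?case using insert a b A
    by (auto intro!: bexI[of _ "a * prod f I + g i * b"] subring_add subring_mult subring_prod)
qed (use subring_0[OF A] in \<open>auto intro!: bexI[of _ 0]\<close>)

lemma sum_cong_mod_2: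
  assumes A: "subring A" and "\<And>i. i \<in> I \<Longrightarrow> (\<exists>a\<in>A. f i - g i = 2 * a)"
  shows "\<exists>a\<in>A. sum f I - sum g I = (2 :: 'a::comm_ring_1) * a"
  using assms(2)
proof (induction I rule: infinite_finite_induct)
  case (insert i I)
  from insert.prems[of i] obtain a where a: "a \<in> A" "f i - g i = 2 * a" by auto
  from insert.IH insert.prems obtain b where b: "b \<in> A" "sum f I - sum g I = 2 * b" by auto
  have "sum f (insert i I) - sum g (insert i I) = (f i - g i) + (sum f I - sum g I)"
    using insert by (simp add: algebra_simps)
  also have "\<dots> = 2 * (a + b)" unfolding a b by (simp add: algebra_simps)
  finally show ?case using subring_add[OF A a(1) b(1)] by blast
qed (use subring_0[OF A] in \<open>auto intro!: bexI[of _ 0]\<close>)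

lemma det_in_subring:
  assumes A: "subring A" and G: "G \<in> carrier_mat n n" and "\<And>i j. i < n \<Longrightarrow> j < n \<Longrightarrow> G $$ (i, j) \<in> A"
  shows "det G \<in> (A :: 'a::comm_ring_1 set)"
  unfolding det_def'[OF G]
proof (intro subring_sum[OF A] subring_mult[OF A] subring_prod[OF A])
  fix p assume p: "p \<in> {p. p permutes {0..<n}}"
  show "signof p \<in> A" using subring_1[OF A] subring_uminus[OF A] by (auto simp: sign_def)
  fix i assume "i \<in> {0..<n}"
  thus "G $$ (i, p i) \<in> A" using p assms(3) permutes_in_image[of p "{0..<n}" i] by auto
qed

lemma det_cong_mod_2:
  assumes A: "subring A" and G: "G \<in> carrier_mat n n" "H \<in> carrier_mat n n"
    and "\<And>i j. i < n \<Longrightarrow> j < n \<Longrightarrow> G $$ (i, j) \<in> A \<and> H $$ (i, j) \<in> A \<and> (\<exists>a\<in>A. G $$ (i, j) - H $$ (i, j) = 2 * a)"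
  shows "\<exists>a\<in>A. det G - det H = (2 :: 'a::comm_ring_1) * a"
  unfolding det_def'[OF G(1)] det_def'[OF G(2)]
proof (rule sum_cong_mod_2[OF A])
  fix p assume p: "p \<in> {p. p permutes {0..<n}}"
  have "\<exists>a\<in>A. (\<Prod>i = 0..<n. G $$ (i, p i)) - (\<Prod>i = 0..<n. H $$ (i, p i)) = 2 * a"
    by (rule prod_cong_mod_2[OF A]) (use p assms(4) permutes_in_image[of p "{0..<n}"] in auto)
  then obtain a where a: "a \<in> A" "(\<Prod>i = 0..<n. G $$ (i, p i)) - (\<Prod>i = 0..<n. H $$ (i, p i)) = 2 * a" by blast
  have s: "signof p \<in> A" using subring_1[OF A] subring_uminus[OF A] by (auto simp: sign_def)
  have "signof p * (\<Prod>i = 0..<n. G $$ (i, p i)) - signof p * (\<Prod>i = 0..<n. H $$ (i, p i)) = 2 * (signof p * a)"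
    unfolding right_diff_distrib[symmetric] a(2) by (simp only: mult.left_commute)
  thus "\<exists>a\<in>A. signof p * (\<Prod>i = 0..<n. G $$ (i, p i)) - signof p * (\<Prod>i = 0..<n. H $$ (i, p i)) = 2 * a"
    using subring_mult[OF A s a(1)] by blast
qed

lemma det_skew_odd:
  fixes S :: "real mat"
  assumes S: "S \<in> carrier_mat n n" and "odd n" and "S\<^sup>T = (- 1) \<cdot>\<^sub>m S"
  shows "det S = 0"
proof -
  have "det S = det (S\<^sup>T)" using det_transpose[OF S] by simp
  also have "\<dots> = (- 1) ^ n * det S" unfolding assms(3) using S by simp
  finally show ?thesis using assms(2) by simp
qed

text \<open>If \<open>y\<close> are the edge vectors at a vertex of a simplex with finite edges, the hypotheses hold by polarisation.
The doubled Gram matrix has determinant \<open>2\<^sup>n det\<^sup>2\<close>, and valuation rings contain the square roots of their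
elements. For odd \<open>n\<close> one factor \<open>2\<close> is left over. It divides the Gram determinant in \<open>A\<close>:
the matrix is symmetric with diagonal in \<open>2 A\<close>, hence congruent modulo \<open>2 A\<close> to a skew-symmetric matrix of
odd size, whose determinant is zero.\<close>

lemma simplex_volume_integral:
  fixes y :: "nat \<Rightarrow> nat \<Rightarrow> real"
  assumes A: "valuation_ring A"
    and off: "\<And>i j. i < n \<Longrightarrow> j < n \<Longrightarrow> 2 * (\<Sum>k<n. y i k * y j k) \<in> A"
    and diag: "\<And>i. i < n \<Longrightarrow> (\<Sum>k<n. y i k * y i k) \<in> A"
  shows "2 ^ (n div 2) * det (mat n n (\<lambda>(i, j). y j i)) \<in> A"
proof -
  note subr = val_subring[OF A]
  define B where "B = mat n n (\<lambda>(i, j). y j i)"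
  define G where "G = mat n n (\<lambda>(i, j). 2 * (\<Sum>k<n. y i k * y j k))"
  have B: "B \<in> carrier_mat n n" and G: "G \<in> carrier_mat n n" by (simp_all add: B_def G_def)
  have "G = 2 \<cdot>\<^sub>m (B\<^sup>T * B)"
    by (rule eq_matI) (auto simp: G_def B_def scalar_prod_def atLeast0LessThan)
  hence "det G = 2 ^ n * (det (B\<^sup>T) * det B)" using B by (simp add: det_mult[of _ n])
  hence dG: "det G = 2 ^ n * (det B * det B)" using det_transpose[OF B] by simp
  have GA: "G $$ (i, j) \<in> A" if "i < n" "j < n" for i j using that off by (simp add: G_def)
  define w where "w = 2 ^ (n div 2) * det B"
  have "w * w \<in> A"
  proof (cases "even n")
    case True
    then obtain k where "n = 2 * k" by blast
    hence "det G = w * w" unfolding dG w_def by (simp add: mult_2 power_add)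
    thus ?thesis using det_in_subring[OF subr G GA] by simp
  next
    case False
    then obtain k where k: "n = 2 * k + 1" using oddE by blast
    \<comment> \<open>The skew-symmetric matrix that agrees with \<open>G\<close> above the diagonal.\<close>
    define S where "S = mat n n (\<lambda>(i, j). if i < j then G $$ (i, j) else if j < i then - G $$ (i, j) else 0)"
    have S: "S \<in> carrier_mat n n" by (simp add: S_def)
    have symG: "G $$ (i, j) = G $$ (j, i)" if "i < n" "j < n" for i j
      using that by (simp add: G_def mult.commute)
    have "det S = 0"
      by (rule det_skew_odd[OF S False], rule eq_matI) (auto simp: S_def symG)
    moreover have "\<exists>a\<in>A. det G - det S = 2 * a"
    proof (rule det_cong_mod_2[OF subr G S])
      fix i j assume ij: "i < n" "j < n"
      have "S $$ (i, j) \<in> A" using ij GA subring_uminus[OF subr] subring_0[OF subr] by (auto simp: S_def)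
      moreover have "\<exists>a\<in>A. G $$ (i, j) - S $$ (i, j) = 2 * a"
      proof (cases i j rule: linorder_cases)
        case less
        thus ?thesis using ij subring_0[OF subr] by (auto simp: S_def)
      next
        case equal
        thus ?thesis using ij diag[of i] by (auto simp: S_def G_def)
      next
        case greater
        thus ?thesis using ij GA[OF ij] by (auto simp: S_def)
      qed
      ultimately show "G $$ (i, j) \<in> A \<and> S $$ (i, j) \<in> A \<and> (\<exists>a\<in>A. G $$ (i, j) - S $$ (i, j) = 2 * a)"
        using GA[OF ij] by blast
    qed
    ultimately obtain a where "a \<in> A" "det G = 2 * a" by auto
    moreover have "det G = 2 * (w * w)"
    proof -
      have "(2::real) ^ n = 2 * (2 ^ k * 2 ^ k)" unfolding k power_add mult_2 by simp
      moreover have "n div 2 = k" using k by simp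
      ultimately show ?thesis by (simp add: dG w_def)
    qed
    ultimately show ?thesis by simp
  qed
  thus ?thesis unfolding w_def B_def by (rule square_root_in_valuation_ring[OF A])
qed

text \<open>The cycle bounds a chain of simplices with finite edges, and its volume is the sum of theirs. The rank
bound needed for this is that of the lifts \<open>(- 2 x, \<bar>x\<bar>\<^sup>2, 1)\<close> and \<open>(x, 1, \<bar>x\<bar>\<^sup>2)\<close>, whose scalar products are the
squared distances.\<close>

lemma volume_of_finite_cycle_integral:
  fixes x :: "nat \<Rightarrow> nat \<Rightarrow> real"
  assumes A: "valuation_ring A" and V: "finite V" and n: "n \<ge> 3"
    and l: "\<And>u v. l u v = (\<Sum>i<n. (x u i - x v i)\<^sup>2)"
    and X: "X = {s. s \<subseteq> V \<and> (\<forall>u\<in>s. \<forall>v\<in>s. l u v \<in> A)}"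
    and z: "supported n X z" "\<forall>s. boundary V z s = 0"
  shows "2 ^ (n div 2) * pairing V (det_of_list n (\<lambda>w. vec n (\<lambda>i. x w i - q i))) z \<in> A"
proof -
  note subr = val_subring[OF A]
  define \<phi> where "\<phi> = (\<lambda>u j. if j < n then - 2 * x u j else if j = n then (\<Sum>i<n. (x u i)\<^sup>2) else 1)"
  define \<psi> where "\<psi> = (\<lambda>v j. if j < n then x v j else if j = n then 1 else (\<Sum>i<n. (x v i)\<^sup>2))"
  have rank: "l u v = (\<Sum>j<n + 2. \<phi> u j * \<psi> v j)" for u v
    by (simp add: l \<phi>_def \<psi>_def power2_diff sum.distrib sum_subtractf sum_negf algebra_simps)
  have sym: "l u v = l v u" for u v unfolding l by (simp add: power2_commute)
  have diag: "l u u = 0" for u unfolding l by simp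
  obtain c where c: "supported (Suc n) X c" "\<forall>s. boundary V c s = z s"
    using finite_distance_cycles_bound[OF A V sym diag rank _ X z] n by auto
  let ?g = "det_of_list n (\<lambda>w. vec n (\<lambda>i. x w i - q i))"
  have "z = boundary V c" using c(2) by auto
  hence "2 ^ (n div 2) * pairing V ?g z = 2 ^ (n div 2) * (\<Sum>t\<in>Pow V. of_int (c t) *
    (\<Sum>v\<in>t. of_int (shuffle_sign v (t - {v})) * ?g (sorted_list_of_set (t - {v}))))"
    using pairing_boundary[OF V, of ?g c] by simp
  also have "\<dots> = (\<Sum>t\<in>Pow V. of_int (c t) * (2 ^ (n div 2) *
    (\<Sum>v\<in>t. of_int (shuffle_sign v (t - {v})) * ?g (sorted_list_of_set (t - {v})))))"
    by (subst sum_distrib_left) (simp only: mult.left_commute)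
  also have "\<dots> \<in> A"
  proof (rule subring_sum[OF subr])
    fix t assume "t \<in> Pow V"
    show "of_int (c t) * (2 ^ (n div 2) *
      (\<Sum>v\<in>t. of_int (shuffle_sign v (t - {v})) * ?g (sorted_list_of_set (t - {v})))) \<in> A"
    proof (cases "c t = 0")
      case True thus ?thesis using subring_0[OF subr] by simp
    next
      case False
      hence t: "t \<in> X" "finite t" "card t = Suc n" using c(1) by (auto simp: supported_def)
      define L where "L = sorted_list_of_set t"
      have L: "length L = Suc n" "set L = t" using t by (simp_all add: L_def)
      hence Lt: "L ! i \<in> t" if "i < Suc n" for i using that nth_mem by metis
      have lA: "l (L ! i) (L ! j) \<in> A" if "i < Suc n" "j < Suc n" for i j
        using that Lt t(1) by (auto simp: X)
      define y where "y = (\<lambda>j i. x (L ! Suc j) i - x (L ! 0) i)"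
      have d: "(\<Sum>k<n. y i k * y i k) = l (L ! Suc i) (L ! 0)" for i
        by (simp add: y_def l power2_eq_square)
      have "2 * (\<Sum>k<n. y i k * y j k) = l (L ! Suc i) (L ! 0) + l (L ! Suc j) (L ! 0) - l (L ! Suc i) (L ! Suc j)" for i j
        unfolding l sum.distrib[symmetric] sum_subtractf[symmetric] sum_distrib_left
        by (rule sum.cong) (auto simp: y_def power2_eq_square algebra_simps)
      hence "2 ^ (n div 2) * det (mat n n (\<lambda>(i, j). y j i)) \<in> A"
        by (intro simplex_volume_integral[OF A]) (auto simp: d intro!: lA subring_add subring_diff subr)
      thus ?thesis
        unfolding boundary_volume_of_simplex[OF t(2,3), where x=x and q=q] L_def[symmetric] y_def
        by (rule subring_mult[OF subr subring_of_int[OF subr]])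
    qed
  qed
  finally show ?thesis .
qed

section \<open>The fundamental cycle\<close>

lemma pairing_sum: "pairing V g (\<lambda>s. \<Sum>i\<in>I. c i s) = (\<Sum>i\<in>I. pairing V g (c i))"
  unfolding pairing_def of_int_sum sum_distrib_right by (rule sum.swap)

text \<open>Vertices are numbered by \<open>f\<close>, since chains need a linear order of the vertices.\<close>

definition fundamental_chain ::
  "nat \<Rightarrow> 'v set set \<Rightarrow> ('v set \<Rightarrow> 'v list set) \<Rightarrow> ('v \<Rightarrow> nat) \<Rightarrow> chain" where
  "fundamental_chain k K ori f =
     (\<lambda>s. \<Sum>\<sigma>\<in>simplices k K. oriented_simplex (map f (SOME vs. vs \<in> ori \<sigma>)) s)"

lemma simplex_orientation_some:
  assumes "simplex_orientation \<sigma> A"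
  shows "(SOME vs. vs \<in> A) \<in> A" and "vs \<in> A \<Longrightarrow> set vs = \<sigma> \<and> distinct vs"
proof -
  from assms obtain ws where ws: "distinct ws" "set ws = \<sigma>"
    "A = {permute_list p ws | p. p permutes {..<length ws} \<and> evenperm p}"
    by (auto simp: simplex_orientation_def)
  have "permute_list id ws \<in> A" using ws(3) permutes_id evenperm_id by blast
  thus "(SOME vs. vs \<in> A) \<in> A" by (metis someI)
  show "vs \<in> A \<Longrightarrow> set vs = \<sigma> \<and> distinct vs" using ws by auto
qed

text \<open>Any ordering in the orientation may be used to compute the boundary; the one starting with the vertex \<open>u\<close>
opposite to the facet shows the induced orientation directly.\<close>

lemma boundary_of_facet:
  assumes V: "finite V" and o: "simplex_orientation (insert u \<rho>) A" and u: "u \<notin> \<rho>"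
    and f: "inj_on f (insert u \<rho>)" and fV: "f u \<in> V"
    and vs: "distinct (x # y # vs)" "set (x # y # vs) = \<rho>" and xs: "xs \<in> A"
  shows "boundary V (oriented_simplex (map f xs)) (f ` \<rho>) =
    (if u # x # y # vs \<in> A then 1 else - 1) * oriented_simplex (map f (x # y # vs)) (f ` \<rho>)"
proof -
  have fu: "f u \<notin> f ` \<rho>" using f u by (auto simp: inj_on_def)
  have bd: "boundary V (oriented_simplex (map f (u # ys))) (f ` \<rho>) = oriented_simplex (map f ys) (f ` \<rho>)" for ys
    using boundary_wedge[OF V fV, of "oriented_simplex (map f ys)" "f ` \<rho>"] fu
    by (simp add: oriented_simplex_def wedge_def)
  show ?thesis
  proof (cases "u # x # y # vs \<in> A")
    case True
    thus ?thesis using bd[of "x # y # vs"] orientation_simplex_unique[OF o f xs True] by simp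
  next
    case False
    hence A: "u # y # x # vs \<in> A" using orientation_contains_one_of[OF o u vs] by blast
    show ?thesis using bd[of "y # x # vs"] orientation_simplex_unique[OF o f xs A] False
      oriented_simplex_swap[of "f y" "f x" "map f vs" "f ` \<rho>"] by simp
  qed
qed

text \<open>Only the two simplices containing a given codimension one face contribute to the boundary there, and by
consistency of the orientations they contribute with opposite signs.\<close>

lemma boundary_fundamental_chain:
  assumes k: "k \<ge> 2" and K: "finite K" and pm: "pseudo_manifold k K"
    and co: "consistent_orientation k K ori" and f: "inj_on f (\<Union>K)"
  shows "boundary (f ` \<Union>K) (fundamental_chain k K ori f) s = 0"
proof -
  have sc: "simplicial_complex K" using pm by (simp add: pseudo_manifold_def)
  have fin: "finite \<sigma>" if "\<sigma> \<in> K" for \<sigma> using sc that by (auto simp: simplicial_complex_def)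
  have sub: "\<tau> \<in> K" if "\<sigma> \<in> K" "\<tau> \<subseteq> \<sigma>" for \<sigma> \<tau> using sc that by (auto simp: simplicial_complex_def)
  define V where "V = f ` \<Union>K"
  have V: "finite V" using K fin by (auto simp: V_def)
  let ?L = "\<lambda>\<sigma>. SOME vs. vs \<in> ori \<sigma>"
  let ?F = "simplices k K"
  have o: "simplex_orientation \<sigma> (ori \<sigma>)" if "\<sigma> \<in> ?F" for \<sigma>
    using co that by (auto simp: consistent_orientation_def)
  have L: "?L \<sigma> \<in> ori \<sigma>" "set (?L \<sigma>) = \<sigma>" if "\<sigma> \<in> ?F" for \<sigma>
    using simplex_orientation_some[OF o[OF that]] by auto
  have sK: "\<sigma> \<in> K" "card \<sigma> = Suc k" if "\<sigma> \<in> ?F" for \<sigma> using that by (auto simp: simplices_def)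
  have sub_inj: "\<rho> \<subseteq> \<sigma>" if h: "f ` \<rho> \<subseteq> f ` \<sigma>" "\<rho> \<in> K" "\<sigma> \<in> K" for \<rho> \<sigma>
  proof
    fix u assume u: "u \<in> \<rho>"
    then obtain u' where u': "u' \<in> \<sigma>" "f u = f u'" using h(1) by blast
    have "u \<in> \<Union>K" "u' \<in> \<Union>K" using u u'(1) h(2,3) by auto
    hence "u = u'" using inj_onD[OF f u'(2)] by blast
    thus "u \<in> \<sigma>" using u'(1) by simp
  qed
  have facet: "\<exists>\<rho>. \<rho> \<subseteq> \<sigma> \<and> card \<rho> = k \<and> s = f ` \<rho>"
    if \<sigma>: "\<sigma> \<in> ?F" and nz: "boundary V (oriented_simplex (map f (?L \<sigma>))) s \<noteq> 0" for \<sigma>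
  proof -
    from nz obtain v where "contract v (oriented_simplex (map f (?L \<sigma>))) s \<noteq> 0"
      unfolding boundary_def by (meson sum.not_neutral_contains_not_neutral)
    hence v: "v \<notin> s" "oriented_simplex (map f (?L \<sigma>)) (insert v s) \<noteq> 0"
      by (auto simp: contract_def split: if_splits)
    hence ins: "insert v s = f ` \<sigma>" using oriented_simplex_support[OF v(2)] L[OF \<sigma>] by simp
    have fs: "inj_on f \<sigma>" using f sK[OF \<sigma>] by (meson Union_upper inj_on_subset)
    from ins obtain u where u: "u \<in> \<sigma>" "v = f u" by auto
    have "s = f ` (\<sigma> - {u})"
      using ins v(1) u fs by (auto simp: inj_on_def)
    thus ?thesis using u sK[OF \<sigma>] fin by (intro exI[of _ "\<sigma> - {u}"]) auto
  qed
  have "boundary V (fundamental_chain k K ori f) s = (\<Sum>\<sigma>\<in>?F. boundary V (oriented_simplex (map f (?L \<sigma>))) s)"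
    unfolding fundamental_chain_def by (rule boundary_sum)
  also have "\<dots> = 0"
  proof (cases "\<exists>\<sigma>\<in>?F. boundary V (oriented_simplex (map f (?L \<sigma>))) s \<noteq> 0")
    case False
    thus ?thesis by (intro sum.neutral) blast
  next
    case True
    then obtain \<sigma>0 \<rho> where \<rho>: "\<sigma>0 \<in> ?F" "\<rho> \<subseteq> \<sigma>0" "card \<rho> = k" "s = f ` \<rho>"
      using facet by blast
    have \<rho>K: "\<rho> \<in> K" using sub sK \<rho>(1,2) by blast
    obtain ws where ws: "set ws = \<rho>" "distinct ws" using finite_distinct_list fin[OF \<rho>K] by blast
    have "length ws = k" using ws \<rho>(3) distinct_card by fastforce
    then obtain x y vs where vs: "ws = x # y # vs" using k
      by (metis Suc_le_length_iff numeral_2_eq_2)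
    have "card {\<sigma> \<in> ?F. \<rho> \<subseteq> \<sigma>} = 2" using pm \<rho>K \<rho>(3) by (auto simp: pseudo_manifold_def)
    then obtain \<sigma> \<tau> where st: "{\<sigma> \<in> ?F. \<rho> \<subseteq> \<sigma>} = {\<sigma>, \<tau>}" "\<sigma> \<noteq> \<tau>" by (auto simp: card_2_iff)
    hence mem: "\<sigma> \<in> ?F" "\<tau> \<in> ?F" "\<rho> \<subseteq> \<sigma>" "\<rho> \<subseteq> \<tau>" by auto
    have ins: "\<exists>u. u \<notin> \<rho> \<and> \<upsilon> = insert u \<rho>" if "\<upsilon> \<in> ?F" "\<rho> \<subseteq> \<upsilon>" for \<upsilon>
    proof -
      have "card (\<upsilon> - \<rho>) = 1"
        using that sK[OF that(1)] \<rho>(3) fin \<rho>K by (simp add: card_Diff_subset)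
      then obtain u where "\<upsilon> - \<rho> = {u}" by (auto simp: card_1_singleton_iff)
      thus ?thesis using that(2) by (intro exI[of _ u]) auto
    qed
    obtain u where u: "u \<notin> \<rho>" "\<sigma> = insert u \<rho>" using ins mem by blast
    obtain w where w: "w \<notin> \<rho>" "\<tau> = insert w \<rho>" using ins mem by blast
    have inj: "inj_on f \<sigma>" "inj_on f \<tau>" using f sK mem by (meson Union_upper inj_on_subset)+
    have inV: "f u \<in> V" "f w \<in> V" using sK mem u w by (auto simp: V_def)
    have disj: "induced_orientation (ori \<sigma>) \<rho> \<inter> induced_orientation (ori \<tau>) \<rho> = {}"
      using co mem st(2) \<rho>K \<rho>(3) unfolding consistent_orientation_def by blast
    have bs: "boundary V (oriented_simplex (map f (?L \<sigma>))) s =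
        (if u # x # y # vs \<in> ori \<sigma> then 1 else - 1) * oriented_simplex (map f (x # y # vs)) s"
      unfolding \<rho>(4)
    proof (rule boundary_of_facet[where f = f and u = u, OF V _ u(1) _ inV(1)])
      show "simplex_orientation (insert u \<rho>) (ori \<sigma>)" "inj_on f (insert u \<rho>)"
        using o[OF mem(1)] inj(1) u(2) by simp_all
    qed (use ws vs L(1)[OF mem(1)] in auto)
    have bt: "boundary V (oriented_simplex (map f (?L \<tau>))) s =
        (if w # x # y # vs \<in> ori \<tau> then 1 else - 1) * oriented_simplex (map f (x # y # vs)) s"
      unfolding \<rho>(4)
    proof (rule boundary_of_facet[where f = f and u = w, OF V _ w(1) _ inV(2)])
      show "simplex_orientation (insert w \<rho>) (ori \<tau>)" "inj_on f (insert w \<rho>)"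
        using o[OF mem(2)] inj(2) w(2) by simp_all
    qed (use ws vs L(1)[OF mem(2)] in auto)
    have iff: "u # x # y # vs \<in> ori \<sigma> \<longleftrightarrow> w # x # y # vs \<notin> ori \<tau>"
    proof
      assume "u # x # y # vs \<in> ori \<sigma>"
      hence "x # y # vs \<in> induced_orientation (ori \<sigma>) \<rho>" using u ws vs by (auto simp: induced_orientation_def)
      hence "x # y # vs \<notin> induced_orientation (ori \<tau>) \<rho>" using disj by blast
      thus "w # x # y # vs \<notin> ori \<tau>" using w ws vs by (auto simp: induced_orientation_def)
    next
      assume nt: "w # x # y # vs \<notin> ori \<tau>"
      show "u # x # y # vs \<in> ori \<sigma>"
      proof (rule ccontr)
        assume ns: "u # x # y # vs \<notin> ori \<sigma>"
        have "u # y # x # vs \<in> ori \<sigma>"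
          using orientation_contains_one_of[of u \<rho> "ori \<sigma>" x y vs] o[OF mem(1)] u ws vs ns by auto
        hence "y # x # vs \<in> induced_orientation (ori \<sigma>) \<rho>" using u ws vs by (auto simp: induced_orientation_def)
        moreover have "w # y # x # vs \<in> ori \<tau>"
          using orientation_contains_one_of[of w \<rho> "ori \<tau>" x y vs] o[OF mem(2)] w ws vs nt by auto
        hence "y # x # vs \<in> induced_orientation (ori \<tau>) \<rho>" using w ws vs by (auto simp: induced_orientation_def)
        ultimately show False using disj by blast
      qed
    qed
    have "(\<Sum>\<sigma>\<in>?F. boundary V (oriented_simplex (map f (?L \<sigma>))) s) =
        (\<Sum>\<upsilon>\<in>{\<sigma>, \<tau>}. boundary V (oriented_simplex (map f (?L \<upsilon>))) s)"
    proof (rule sum.mono_neutral_right)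
      show "finite ?F" using K by (simp add: simplices_def)
      show "{\<sigma>, \<tau>} \<subseteq> ?F" using mem by simp
      show "\<forall>\<upsilon>\<in>?F - {\<sigma>, \<tau>}. boundary V (oriented_simplex (map f (?L \<upsilon>))) s = 0"
      proof (intro ballI, rule ccontr)
        fix \<upsilon> assume h: "\<upsilon> \<in> ?F - {\<sigma>, \<tau>}" "boundary V (oriented_simplex (map f (?L \<upsilon>))) s \<noteq> 0"
        then obtain \<rho>' where r: "\<rho>' \<subseteq> \<upsilon>" "s = f ` \<rho>'" using facet[of \<upsilon>] by auto
        have "\<upsilon> \<in> K" using h sK by blast
        hence "\<rho> \<subseteq> \<upsilon>" using sub_inj[of \<rho> \<upsilon>] \<rho>K r \<rho>(4) by auto
        hence "\<upsilon> \<in> {\<sigma> \<in> ?F. \<rho> \<subseteq> \<sigma>}" using h by simp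
        thus False using st(1) h by simp
      qed
    qed
    also have "\<dots> = 0" using st(2) bs bt iff by auto
    finally show ?thesis .
  qed
  finally show ?thesis by (simp add: V_def)
qed

lemma fundamental_chain_support:
  assumes co: "consistent_orientation k K ori" and f: "inj_on f (\<Union>K)"
    and "fundamental_chain k K ori f s \<noteq> 0"
  shows "\<exists>\<sigma>\<in>simplices k K. s = f ` \<sigma>"
proof -
  from assms(3) obtain \<sigma> where \<sigma>: "\<sigma> \<in> simplices k K" "oriented_simplex (map f (SOME vs. vs \<in> ori \<sigma>)) s \<noteq> 0"
    unfolding fundamental_chain_def by (meson sum.not_neutral_contains_not_neutral)
  have "simplex_orientation \<sigma> (ori \<sigma>)" using co \<sigma>(1) by (auto simp: consistent_orientation_def)
  hence "set (SOME vs. vs \<in> ori \<sigma>) = \<sigma>" using simplex_orientation_some by blast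
  thus ?thesis using oriented_simplex_support[OF \<sigma>(2)] \<sigma>(1) by auto
qed

section \<open>Evaluation of integer polynomials\<close>

definition eval_monom :: "('x \<Rightarrow> 'r::comm_ring_1) \<Rightarrow> ('x \<Rightarrow>\<^sub>0 nat) \<Rightarrow> 'r" where
  "eval_monom a m = (\<Prod>x\<in>Poly_Mapping.keys m. a x ^ Poly_Mapping.lookup m x)"

lemma eval_monom_superset:
  assumes "finite X" "Poly_Mapping.keys m \<subseteq> X"
  shows "eval_monom a m = (\<Prod>x\<in>X. a x ^ Poly_Mapping.lookup m x)"
  unfolding eval_monom_def by (rule prod.mono_neutral_left) (use assms in \<open>auto simp: in_keys_iff\<close>)

lemma eval_monom_add: "eval_monom a (m + m') = eval_monom a m * eval_monom a m'"
proof -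
  let ?X = "Poly_Mapping.keys m \<union> Poly_Mapping.keys m'"
  have "eval_monom a (m + m') = (\<Prod>x\<in>?X. a x ^ Poly_Mapping.lookup (m + m') x)"
    by (rule eval_monom_superset) (use Poly_Mapping.keys_add[of m m'] in auto)
  thus ?thesis
    by (simp add: eval_monom_superset[of ?X] lookup_add power_add prod.distrib)
qed

lemma eval_mpoly_superset:
  assumes "finite S" "Poly_Mapping.keys p \<subseteq> S"
  shows "eval_mpoly a p = (\<Sum>m\<in>S. of_int (Poly_Mapping.lookup p m) * eval_monom a m)"
  unfolding eval_mpoly_def eval_monom_def[symmetric]
  by (rule sum.mono_neutral_left) (use assms in \<open>auto simp: in_keys_iff\<close>)

lemma eval_mpoly_diff: "eval_mpoly a (p - q) = eval_mpoly a p - eval_mpoly a q"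
proof -
  let ?S = "Poly_Mapping.keys p \<union> Poly_Mapping.keys q"
  have "Poly_Mapping.keys (p - q) \<subseteq> ?S" by (auto simp: in_keys_iff lookup_minus)
  thus ?thesis
    by (simp add: eval_mpoly_superset[of ?S] lookup_minus left_diff_distrib sum_subtractf)
qed

lemma eval_mpoly_0 [simp]: "eval_mpoly a 0 = 0"
  by (simp add: eval_mpoly_def)

lemma eval_mpoly_uminus: "eval_mpoly a (- p) = - eval_mpoly a p"
  using eval_mpoly_diff[of a 0 p] by simp

lemma eval_mpoly_add: "eval_mpoly a (p + q) = eval_mpoly a p + eval_mpoly a q"
  using eval_mpoly_diff[of a p "- q"] by (simp add: eval_mpoly_uminus)

lemma eval_mpoly_sum: "eval_mpoly a (\<Sum>i\<in>I. p i) = (\<Sum>i\<in>I. eval_mpoly a (p i))"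
  by (induction I rule: infinite_finite_induct) (auto simp: eval_mpoly_add)

lemma eval_mpoly_single: "eval_mpoly a (Poly_Mapping.single m c) = of_int c * eval_monom a m"
  by (simp add: eval_mpoly_def eval_monom_def)

lemma poly_mapping_as_sum:
  "p = (\<Sum>m\<in>Poly_Mapping.keys p. Poly_Mapping.single m (Poly_Mapping.lookup p m))"
  by (rule poly_mapping_eqI) (simp add: lookup_sum lookup_single when_def in_keys_iff)

lemma eval_mpoly_mult: "eval_mpoly a (p * q) = eval_mpoly a p * eval_mpoly a q"
proof -
  let ?c = "Poly_Mapping.lookup"
  have "p * q = (\<Sum>m\<in>Poly_Mapping.keys p. \<Sum>m'\<in>Poly_Mapping.keys q.
      Poly_Mapping.single (m + m') (?c p m * ?c q m'))"
    by (subst (1) poly_mapping_as_sum[of p], subst (1) poly_mapping_as_sum[of q])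
       (simp only: sum_product mult_single)
  hence "eval_mpoly a (p * q) = (\<Sum>m\<in>Poly_Mapping.keys p. \<Sum>m'\<in>Poly_Mapping.keys q.
      (of_int (?c p m) * eval_monom a m) * (of_int (?c q m') * eval_monom a m'))"
    by (simp add: eval_mpoly_sum eval_mpoly_single eval_monom_add mult_ac)
  thus ?thesis by (simp add: eval_mpoly_def eval_monom_def sum_product)
qed

lemma polys_over_diff: "p \<in> polys_over X \<Longrightarrow> q \<in> polys_over X \<Longrightarrow> p - q \<in> polys_over X"
proof -
  have "Poly_Mapping.keys (p - q) \<subseteq> Poly_Mapping.keys p \<union> Poly_Mapping.keys q"
    by (auto simp: in_keys_iff lookup_minus)
  thus "p \<in> polys_over X \<Longrightarrow> q \<in> polys_over X \<Longrightarrow> p - q \<in> polys_over X"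
    unfolding polys_over_def by blast
qed

lemma polys_over_mult:
  assumes "p \<in> polys_over X" "q \<in> polys_over X"
  shows "p * q \<in> polys_over X"
  unfolding polys_over_def
proof (intro CollectI ballI)
  fix m assume "m \<in> Poly_Mapping.keys (p * q)"
  then obtain u v where m: "m = u + v" "u \<in> Poly_Mapping.keys p" "v \<in> Poly_Mapping.keys q"
    using Poly_Mapping.keys_mult[of p q] by blast
  have "Poly_Mapping.keys u \<union> Poly_Mapping.keys v \<subseteq> X" using m(2,3) assms unfolding polys_over_def by blast
  thus "Poly_Mapping.keys m \<subseteq> X" unfolding m(1) using Poly_Mapping.keys_add[of u v] by blast
qed

lemma subring_eval_mpoly: "subring (eval_mpoly a ` polys_over X)"
  unfolding subring_def
proof (intro conjI ballI)
  have "1 \<in> polys_over X" by (simp add: polys_over_def)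
  moreover have "eval_mpoly a 1 = 1" by (simp add: eval_mpoly_def)
  ultimately show "1 \<in> eval_mpoly a ` polys_over X" by (metis imageI)
  fix x y assume "x \<in> eval_mpoly a ` polys_over X" "y \<in> eval_mpoly a ` polys_over X"
  then obtain p q where "p \<in> polys_over X" "q \<in> polys_over X" "x = eval_mpoly a p" "y = eval_mpoly a q" by blast
  thus "x - y \<in> eval_mpoly a ` polys_over X" "x * y \<in> eval_mpoly a ` polys_over X"
    by (simp_all add: polys_over_diff polys_over_mult flip: eval_mpoly_diff eval_mpoly_mult)
qed

lemma variable_in_eval_mpoly:
  assumes "x \<in> X"
  shows "a x \<in> eval_mpoly a ` polys_over X"
proof -
  let ?p = "Poly_Mapping.single (Poly_Mapping.single x 1) 1"
  have "?p \<in> polys_over X" using assms by (simp add: polys_over_def)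
  moreover have "eval_mpoly a ?p = a x" by (simp add: eval_mpoly_single eval_monom_def)
  ultimately show ?thesis by (metis imageI)
qed

lemma eval_mpoly_cong:
  assumes "p \<in> polys_over X" "\<And>x. x \<in> X \<Longrightarrow> a x = b x"
  shows "eval_mpoly a p = eval_mpoly b p"
  unfolding eval_mpoly_def
proof (intro sum.cong refl arg_cong2[where f="(*)"] prod.cong)
  fix m x assume "m \<in> Poly_Mapping.keys p" "x \<in> Poly_Mapping.keys m"
  hence "x \<in> X" using assms(1) unfolding polys_over_def by blast
  thus "a x ^ Poly_Mapping.lookup m x = b x ^ Poly_Mapping.lookup m x" using assms(2) by simp
qed

text \<open>A finitely supported function is determined by its graph over the support, which is a finite set.\<close>

lemma countable_poly_mapping_keys:
  assumes X: "countable X"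
  shows "countable {p :: 'a \<Rightarrow>\<^sub>0 'b::{zero,countable}. Poly_Mapping.keys p \<subseteq> X}"
proof -
  define G where "G = (\<lambda>p :: 'a \<Rightarrow>\<^sub>0 'b. (\<lambda>x. (x, Poly_Mapping.lookup p x)) ` Poly_Mapping.keys p)"
  have fin: "countable {T. finite T \<and> T \<subseteq> X \<times> (UNIV :: 'b set)}"
    by (rule countable_Collect_finite_subset) (use X in auto)
  have sub: "G ` {p. Poly_Mapping.keys p \<subseteq> X} \<subseteq> {T. finite T \<and> T \<subseteq> X \<times> (UNIV :: 'b set)}"
    by (auto simp: G_def)
  from countable_subset[OF sub fin] have "countable (G ` {p. Poly_Mapping.keys p \<subseteq> X})" .
  moreover have "inj G"
  proof (rule injI)
    fix p q assume "G p = G q"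
    hence iff: "(x, c) \<in> G p \<longleftrightarrow> (x, c) \<in> G q" for x c by simp
    have mem: "(x, c) \<in> G r \<longleftrightarrow> c \<noteq> 0 \<and> Poly_Mapping.lookup r x = c" for x c r
      by (auto simp: G_def in_keys_iff)
    show "p = q"
    proof (rule poly_mapping_eqI)
      fix x
      show "Poly_Mapping.lookup p x = Poly_Mapping.lookup q x"
        using iff[of x "Poly_Mapping.lookup p x"] iff[of x "Poly_Mapping.lookup q x"] unfolding mem by metis
    qed
  qed
  ultimately show ?thesis by (meson countable_image_inj_on inj_on_subset subset_UNIV)
qed

lemma countable_polys_over:
  assumes "countable X"
  shows "countable (polys_over X)"
proof -
  have "countable {p :: ('a \<Rightarrow>\<^sub>0 nat) \<Rightarrow>\<^sub>0 int. Poly_Mapping.keys p \<subseteq> {m. Poly_Mapping.keys m \<subseteq> X}}"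
    by (intro countable_poly_mapping_keys assms)
  moreover have "polys_over X = {p. Poly_Mapping.keys p \<subseteq> {m. Poly_Mapping.keys m \<subseteq> X}}"
    by (auto simp: polys_over_def)
  ultimately show ?thesis by simp
qed

section \<open>Generic points\<close>

definition polynomial_in :: "'i \<Rightarrow> (('i \<Rightarrow> real) \<Rightarrow> real) \<Rightarrow> bool" where
  "polynomial_in i F \<longleftrightarrow> (\<forall>y. \<exists>p. \<forall>t. F (y(i := t)) = poly p t)"

lemma polynomial_in_const: "polynomial_in i (\<lambda>y. c)"
  unfolding polynomial_in_def by (intro allI exI[of _ "[:c:]"]) simp

lemma polynomial_in_coordinate: "polynomial_in i (\<lambda>y. y j)"
  unfolding polynomial_in_def
proof (intro allI)
  fix y :: "'a \<Rightarrow> real"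
  show "\<exists>p. \<forall>t. (y(i := t)) j = poly p t"
    by (intro exI[of _ "if j = i then [:0, 1:] :: real poly else [:y j:]"]) simp
qed

lemma polynomial_in_add: "polynomial_in i F \<Longrightarrow> polynomial_in i G \<Longrightarrow> polynomial_in i (\<lambda>y. F y + G y)"
  unfolding polynomial_in_def by (metis poly_add)

lemma polynomial_in_diff: "polynomial_in i F \<Longrightarrow> polynomial_in i G \<Longrightarrow> polynomial_in i (\<lambda>y. F y - G y)"
  unfolding polynomial_in_def by (metis poly_diff)

lemma polynomial_in_mult: "polynomial_in i F \<Longrightarrow> polynomial_in i G \<Longrightarrow> polynomial_in i (\<lambda>y. F y * G y)"
  unfolding polynomial_in_def by (metis poly_mult)

lemma polynomial_in_power: "polynomial_in i F \<Longrightarrow> polynomial_in i (\<lambda>y. F y ^ k)"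
  by (induction k) (auto intro: polynomial_in_const polynomial_in_mult)

lemma polynomial_in_sum: "(\<And>a. a \<in> S \<Longrightarrow> polynomial_in i (F a)) \<Longrightarrow> polynomial_in i (\<lambda>y. \<Sum>a\<in>S. F a y)"
  by (induction S rule: infinite_finite_induct) (auto intro: polynomial_in_const polynomial_in_add)

lemma polynomial_in_prod: "(\<And>a. a \<in> S \<Longrightarrow> polynomial_in i (F a)) \<Longrightarrow> polynomial_in i (\<lambda>y. \<Prod>a\<in>S. F a y)"
  by (induction S rule: infinite_finite_induct) (auto intro: polynomial_in_const polynomial_in_mult)

lemma polynomial_in_det:
  assumes "\<And>a b. a < n \<Longrightarrow> b < n \<Longrightarrow> polynomial_in i (\<lambda>y. M y a b)"
  shows "polynomial_in i (\<lambda>y. det (mat n n (\<lambda>(a, b). M y a b)))"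
proof -
  have "det (mat n n (\<lambda>(a, b). M y a b)) =
      (\<Sum>p | p permutes {0..<n}. signof p * (\<Prod>a\<in>{0..<n}. M y a (p a)))" for y
  proof -
    have "det (mat n n (\<lambda>(a, b). M y a b)) = (\<Sum>p | p permutes {0..<n}. signof p *
        (\<Prod>a = 0..<n. mat n n (\<lambda>(a, b). M y a b) $$ (a, p a)))"
      by (rule det_def'[OF mat_carrier])
    also have "\<dots> = (\<Sum>p | p permutes {0..<n}. signof p * (\<Prod>a\<in>{0..<n}. M y a (p a)))"
    proof (intro sum.cong refl arg_cong2[where f="(*)"] prod.cong)
      fix p a assume "p \<in> {p. p permutes {0..<n}}" "a \<in> {0..<n}"
      hence "a < n" "p a < n" using permutes_in_image[of p "{0..<n}" a] by auto
      thus "mat n n (\<lambda>(a, b). M y a b) $$ (a, p a) = M y a (p a)" by simp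
    qed
    finally show ?thesis .
  qed
  moreover have "polynomial_in i (\<lambda>y. \<Sum>p | p permutes {0..<n}. signof p * (\<Prod>a\<in>{0..<n}. M y a (p a)))"
  proof (intro polynomial_in_sum polynomial_in_mult polynomial_in_const polynomial_in_prod)
    fix p a assume "p \<in> {p. p permutes {0..<n}}" "a \<in> {0..<n}"
    hence "a < n" "p a < n" using permutes_in_image[of p "{0..<n}" a] by auto
    thus "polynomial_in i (\<lambda>y. M y a (p a))" by (rule assms)
  qed
  ultimately show ?thesis by simp
qed

text \<open>The coordinates in \<open>I\<close> are chosen one after the other. Each function keeps its own witness \<open>x\<close> for the
coordinates not yet chosen; as a polynomial in the next coordinate it is nonzero at the witness, hence it has
finitely many roots, and countably many finite sets do not exhaust the reals.\<close>

lemma common_nonzero: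
  assumes "finite I" "countable \<F>"
  shows "(\<And>F i. F \<in> \<F> \<Longrightarrow> i \<in> I \<Longrightarrow> polynomial_in i F) \<Longrightarrow> (\<And>F. F \<in> \<F> \<Longrightarrow> \<exists>x. F x \<noteq> 0) \<Longrightarrow>
    \<exists>y. \<forall>F\<in>\<F>. \<exists>x. F (\<lambda>i. if i \<in> I then y i else x i) \<noteq> (0::real)"
  using assms(1)
proof (induction I rule: finite_induct)
  case empty
  thus ?case by simp
next
  case (insert i I)
  then obtain y where y: "\<forall>F\<in>\<F>. \<exists>x. F (\<lambda>i. if i \<in> I then y i else x i) \<noteq> 0" by blast
  then obtain x where x: "\<forall>F\<in>\<F>. F (\<lambda>j. if j \<in> I then y j else x F j) \<noteq> 0" by metis
  have "\<forall>F\<in>\<F>. \<exists>p. \<forall>t. F ((\<lambda>j. if j \<in> I then y j else x F j)(i := t)) = poly p t"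
    using insert.prems(1) unfolding polynomial_in_def by blast
  then obtain p where p: "\<forall>F\<in>\<F>. \<forall>t. F ((\<lambda>j. if j \<in> I then y j else x F j)(i := t)) = poly (p F) t"
    by metis
  have "countable {t. poly (p F) t = 0}" if F: "F \<in> \<F>" for F
  proof -
    let ?y = "\<lambda>j. if j \<in> I then y j else x F j"
    have "?y(i := x F i) = ?y" using insert.hyps by auto
    moreover have "F (?y(i := x F i)) = poly (p F) (x F i)" using p F by blast
    moreover have "F ?y \<noteq> 0" using x F by blast
    ultimately have "poly (p F) (x F i) \<noteq> 0" by simp
    hence "p F \<noteq> 0" by auto
    thus ?thesis by (intro countable_finite poly_roots_finite)
  qed
  hence "countable (\<Union>F\<in>\<F>. {t. poly (p F) t = 0})" using assms(2) by blast
  hence "(\<Union>F\<in>\<F>. {t. poly (p F) t = 0}) \<noteq> UNIV" using uncountable_UNIV_real by metis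
  then obtain t where t: "\<forall>F\<in>\<F>. poly (p F) t \<noteq> 0" by blast
  have "F (\<lambda>j. if j \<in> insert i I then (y(i := t)) j else x F j) \<noteq> 0" if F: "F \<in> \<F>" for F
  proof -
    have "(\<lambda>j. if j \<in> insert i I then (y(i := t)) j else x F j) = (\<lambda>j. if j \<in> I then y j else x F j)(i := t)"
      using insert.hyps by auto
    moreover have "F ((\<lambda>j. if j \<in> I then y j else x F j)(i := t)) = poly (p F) t" using p F by blast
    moreover have "poly (p F) t \<noteq> 0" using t F by blast
    ultimately show ?thesis by presburger
  qed
  thus ?case by blast
qed

section \<open>The relation for the volume\<close>

text \<open>All coordinates form one real-valued function, and the index \<open>None\<close> stands for the base point. So the base point
is part of the generic configuration, and the relation is obtained for every base point at once.\<close>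

definition vertex_position :: "nat \<Rightarrow> ('v option \<times> nat \<Rightarrow> real) \<Rightarrow> 'v option \<Rightarrow> real vec" where
  "vertex_position n y w = vec n (\<lambda>i. y (w, i))"

text \<open>Summing over both orientations of the edge avoids choosing an order of its endpoints.\<close>

definition square_length :: "nat \<Rightarrow> ('v option \<times> nat \<Rightarrow> real) \<Rightarrow> 'v set \<Rightarrow> real" where
  "square_length n y e = (\<Sum>a\<in>e. \<Sum>b\<in>e. \<Sum>i<n. (y (Some a, i) - y (Some b, i))\<^sup>2) / 2"

definition weighted_volume ::
  "nat \<Rightarrow> 'v set set \<Rightarrow> ('v set \<Rightarrow> 'v list set) \<Rightarrow> ('v option \<times> nat \<Rightarrow> real) \<Rightarrow> real" where
  "weighted_volume n K ori y = 2 ^ (n div 2) * (\<Sum>\<sigma>\<in>simplices (n - 1) K.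
     det_of_list n (\<lambda>v. vertex_position n y (Some v) - vertex_position n y None) (SOME vs. vs \<in> ori \<sigma>))"

definition relation_value ::
  "nat \<Rightarrow> 'v set set \<Rightarrow> ('v set \<Rightarrow> 'v list set) \<Rightarrow> 'v set int_mpoly list \<Rightarrow> ('v option \<times> nat \<Rightarrow> real) \<Rightarrow> real" where
  "relation_value n K ori bs y = weighted_volume n K ori y ^ (2 * length bs) +
     (\<Sum>i = 1..length bs. eval_mpoly (square_length n y) (bs ! (i - 1)) *
        weighted_volume n K ori y ^ (2 * length bs - 2 * i))"

text \<open>An expression of \<open>w\<close> as a polynomial of degree \<open>m\<close> in \<open>1 / w\<close> is multiplied by \<open>w\<^sup>m\<close>; this gives a monic
equation of degree \<open>m + 1\<close>.\<close>

lemma relation_of_integral: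
  fixes w :: real
  assumes "w \<in> adjoin (eval_mpoly l ` polys_over X) (inverse w)"
  shows "\<exists>bs. bs \<noteq> [] \<and> set bs \<subseteq> polys_over X \<and>
    w ^ length bs + (\<Sum>i = 1..length bs. eval_mpoly l (bs ! (i - 1)) * w ^ (length bs - i)) = 0"
proof (cases "w = 0")
  case True
  \<comment> \<open>Here \<open>inverse w = 0\<close>, and the relation is \<open>w + 0 = 0\<close>.\<close>
  have "(0 :: 'a int_mpoly) \<in> polys_over X" by (simp add: polys_over_def)
  thus ?thesis using True by (intro exI[of _ "[0]"]) auto
next
  case False
  from assms obtain a m where a: "\<forall>i. a i \<in> eval_mpoly l ` polys_over X"
    and w: "w = (\<Sum>i\<le>m. a i * inverse w ^ i)" by (rule adjoinE)
  from a have "\<forall>i. \<exists>q\<in>polys_over X. a i = eval_mpoly l q" by blast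
  then obtain q where q: "\<And>i. q i \<in> polys_over X" "\<And>i. a i = eval_mpoly l (q i)" by metis
  define bs where "bs = map (\<lambda>i. - q i) [0..<Suc m]"
  have len: "length bs = Suc m" by (simp add: bs_def)
  have "w ^ Suc m = w * w ^ m" by simp
  also have "\<dots> = (\<Sum>i\<le>m. a i * inverse w ^ i) * w ^ m" using w by (rule arg_cong)
  also have "\<dots> = (\<Sum>i\<le>m. a i * (inverse w ^ i * w ^ m))" by (simp add: sum_distrib_right mult.assoc)
  also have "\<dots> = (\<Sum>i\<le>m. a i * w ^ (m - i))"
    by (rule sum.cong) (use False in \<open>auto simp: power_diff field_simps\<close>)
  also have "\<dots> = (\<Sum>i = 1..Suc m. a (i - 1) * w ^ (Suc m - i))"
    by (rule sum.reindex_bij_witness[of _ "\<lambda>i. i - 1" Suc]) auto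
  also have "\<dots> = (\<Sum>i = 1..Suc m. - (eval_mpoly l (bs ! (i - 1)) * w ^ (Suc m - i)))"
  proof (rule sum.cong[OF refl])
    fix i assume "i \<in> {1..Suc m}"
    hence "i - 1 < Suc m" by auto
    hence "bs ! (i - 1) = - q (i - 1)" by (simp add: bs_def del: upt_Suc)
    thus "a (i - 1) * w ^ (Suc m - i) = - (eval_mpoly l (bs ! (i - 1)) * w ^ (Suc m - i))"
      by (simp add: q(2) eval_mpoly_uminus)
  qed
  also have "\<dots> = - (\<Sum>i = 1..length bs. eval_mpoly l (bs ! (i - 1)) * w ^ (length bs - i))"
    unfolding len by (rule sum_negf)
  finally have eq: "w ^ length bs + (\<Sum>i = 1..length bs. eval_mpoly l (bs ! (i - 1)) * w ^ (length bs - i)) = 0"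
    unfolding len by linarith
  have "set bs \<subseteq> polys_over X"
  proof
    fix b assume "b \<in> set bs"
    then obtain i where "b = 0 - q i" by (auto simp: bs_def)
    moreover have "0 \<in> polys_over X" by (simp add: polys_over_def)
    ultimately show "b \<in> polys_over X" using polys_over_diff q(1) by metis
  qed
  moreover have "bs \<noteq> []" using len by auto
  ultimately show ?thesis using eq by blast
qed

lemma finite_vertices:
  assumes "finite K" "simplicial_complex K"
  shows "finite (\<Union>K)"
  using assms by (auto simp: simplicial_complex_def)

lemma square_length_edge:
  assumes "a \<noteq> b"
  shows "square_length n y {a, b} = (\<Sum>i<n. (y (Some a, i) - y (Some b, i))\<^sup>2)"
proof -
  have "(\<Sum>i<n. (y (Some b, i) - y (Some a, i))\<^sup>2) = (\<Sum>i<n. (y (Some a, i) - y (Some b, i))\<^sup>2)"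
    by (simp add: power2_commute)
  thus ?thesis using assms by (simp add: square_length_def)
qed

text \<open>All simplices of the fundamental cycle have edges in \<open>K\<close>, so the cycle consists of simplices with finite edges,
and its pairing with the determinant is the volume.\<close>

lemma weighted_volume_in_valuation_ring:
  assumes n: "n \<ge> 3" and K: "finite K" and pm: "pseudo_manifold (n - 1) K"
    and co: "consistent_orientation (n - 1) K ori"
    and A: "valuation_ring A" and lA: "\<And>e. e \<in> edges K \<Longrightarrow> square_length n y e \<in> A"
  shows "weighted_volume n K ori y \<in> A"
proof -
  have sc: "simplicial_complex K" using pm by (simp add: pseudo_manifold_def)
  have finU: "finite (\<Union>K)" using finite_vertices[OF K sc] .
  then obtain f :: "'a \<Rightarrow> nat" where f: "inj_on f (\<Union>K)"
    using finite_imp_inj_to_nat_seg by metis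
  define V where "V = f ` \<Union>K"
  have V: "finite V" using finU by (simp add: V_def)
  \<comment> \<open>Positions indexed by the numbers \<open>f v\<close> instead of the vertices.\<close>
  define x where "x = (\<lambda>w i. y (Some (inv_into (\<Union>K) f w), i))"
  have xf: "x (f v) i = y (Some v, i)" if "v \<in> \<Union>K" for v i
    using that f by (simp add: x_def inv_into_f_f)
  define l where "l = (\<lambda>u v. \<Sum>i<n. (x u i - x v i)\<^sup>2)"
  define X where "X = {s. s \<subseteq> V \<and> (\<forall>u\<in>s. \<forall>v\<in>s. l u v \<in> A)}"
  define z where "z = fundamental_chain (n - 1) K ori f"
  let ?g = "det_of_list n (\<lambda>w. vec n (\<lambda>i. x w i - y (None, i)))"
  have z: "supported n X z"
    unfolding supported_def
  proof (intro allI impI)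
    fix s assume "z s \<noteq> 0"
    then obtain \<sigma> where \<sigma>: "\<sigma> \<in> simplices (n - 1) K" "s = f ` \<sigma>"
      using fundamental_chain_support[OF co f] unfolding z_def by blast
    have sK: "\<sigma> \<in> K" "card \<sigma> = n" using \<sigma>(1) n by (auto simp: simplices_def)
    hence sub: "\<sigma> \<subseteq> \<Union>K" by auto
    have fin: "finite \<sigma>" using sc sK by (auto simp: simplicial_complex_def)
    have "l (f a) (f b) \<in> A" if "a \<in> \<sigma>" "b \<in> \<sigma>" for a b
    proof (cases "a = b")
      case True
      thus ?thesis using subring_0[OF val_subring[OF A]] by (simp add: l_def)
    next
      case False
      have "{a, b} \<in> K" using sc sK that unfolding simplicial_complex_def by (metis empty_subsetI insert_subset)
      hence "{a, b} \<in> edges K" using False by (simp add: edges_def simplices_def)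
      hence "square_length n y {a, b} \<in> A" by (rule lA)
      moreover have "a \<in> \<Union>K" "b \<in> \<Union>K" using that sub by auto
      ultimately show ?thesis by (simp add: square_length_edge[OF False] l_def xf)
    qed
    moreover have "card s = n" using \<sigma>(2) sK(2) f sub by (simp add: card_image inj_on_subset)
    ultimately show "s \<in> X \<and> finite s \<and> card s = n"
      using \<sigma>(2) sub fin by (auto simp: X_def V_def)
  qed
  have "boundary V z s = 0" for s
    unfolding V_def z_def by (rule boundary_fundamental_chain[OF _ K pm co f]) (use n in auto)
  hence main: "2 ^ (n div 2) * pairing V ?g z \<in> A"
    using volume_of_finite_cycle_integral[OF A V n _ X_def z, of x "\<lambda>i. y (None, i)"] by (simp add: l_def)
  have "pairing V ?g z = (\<Sum>\<sigma>\<in>simplices (n - 1) K.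
      pairing V ?g (oriented_simplex (map f (SOME vs. vs \<in> ori \<sigma>))))"
    unfolding z_def fundamental_chain_def by (rule pairing_sum)
  also have "\<dots> = (\<Sum>\<sigma>\<in>simplices (n - 1) K.
     det_of_list n (\<lambda>v. vertex_position n y (Some v) - vertex_position n y None) (SOME vs. vs \<in> ori \<sigma>))"
  proof (rule sum.cong[OF refl])
    fix \<sigma> assume \<sigma>: "\<sigma> \<in> simplices (n - 1) K"
    let ?vs = "SOME vs. vs \<in> ori \<sigma>"
    have "simplex_orientation \<sigma> (ori \<sigma>)" using co \<sigma> by (auto simp: consistent_orientation_def)
    hence "set ?vs = \<sigma>" using simplex_orientation_some by blast
    hence sub: "set ?vs \<subseteq> \<Union>K" using \<sigma> by (auto simp: simplices_def)
    hence "set (map f ?vs) \<subseteq> V" by (auto simp: V_def)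
    hence "pairing V ?g (oriented_simplex (map f ?vs)) = ?g (map f ?vs)"
      by (rule pairing_oriented_simplex[OF V _ alternating_det])
    also have "map (\<lambda>w. vec n (\<lambda>i. x w i - y (None, i))) (map f ?vs) =
        map (\<lambda>v. vertex_position n y (Some v) - vertex_position n y None) ?vs"
      unfolding map_map
    proof (rule map_cong[OF refl])
      fix v assume "v \<in> set ?vs"
      hence "v \<in> \<Union>K" using sub by blast
      thus "((\<lambda>w. vec n (\<lambda>i. x w i - y (None, i))) \<circ> f) v = vertex_position n y (Some v) - vertex_position n y None"
        by (intro eq_vecI) (auto simp: vertex_position_def xf simp del: Union_iff)
    qed
    hence "?g (map f ?vs) = det_of_list n (\<lambda>v. vertex_position n y (Some v) - vertex_position n y None) ?vs"
      unfolding det_of_list_def by (rule arg_cong)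
    finally show "pairing V ?g (oriented_simplex (map f ?vs)) =
      det_of_list n (\<lambda>v. vertex_position n y (Some v) - vertex_position n y None) ?vs" .
  qed
  finally show ?thesis using main by (simp add: weighted_volume_def)
qed

lemma relation_at_each_polyhedron:
  assumes n: "n \<ge> 3" and K: "finite K" and pm: "pseudo_manifold (n - 1) K"
    and co: "consistent_orientation (n - 1) K ori"
  shows "\<exists>bs. bs \<noteq> [] \<and> set bs \<subseteq> polys_over (edges K) \<and> relation_value n K ori bs y = 0"
proof -
  define W where "W = weighted_volume n K ori y"
  define l where "l = square_length n y"
  define R where "R = eval_mpoly l ` polys_over (edges K)"
  have "W ^ 2 \<in> adjoin R (inverse (W ^ 2))"
  proof (rule ccontr)
    assume "W ^ 2 \<notin> adjoin R (inverse (W ^ 2))"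
    from exists_valuation_ring[OF _ this] subring_eval_mpoly[of l "edges K"]
    obtain A where A: "valuation_ring A" "R \<subseteq> A" "W ^ 2 \<notin> A" unfolding R_def by blast
    have "l e \<in> A" if "e \<in> edges K" for e
      using variable_in_eval_mpoly[OF that, of l] A(2) unfolding R_def by blast
    hence "W \<in> A" unfolding W_def l_def by (rule weighted_volume_in_valuation_ring[OF n K pm co A(1)])
    thus False using A subring_power[OF val_subring[OF A(1)]] by blast
  qed
  then obtain bs where bs: "bs \<noteq> []" "set bs \<subseteq> polys_over (edges K)"
    "(W ^ 2) ^ length bs + (\<Sum>i = 1..length bs. eval_mpoly l (bs ! (i - 1)) * (W ^ 2) ^ (length bs - i)) = 0"
    unfolding R_def using relation_of_integral by blast
  have "relation_value n K ori bs y = 0"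
    using bs(3) unfolding relation_value_def W_def l_def
    by (simp add: power_mult[symmetric] diff_mult_distrib2)
  thus ?thesis using bs(1,2) by blast
qed

lemma polynomial_in_relation_value:
  assumes n: "n \<ge> 1" and co: "consistent_orientation (n - 1) K ori"
  shows "polynomial_in i (relation_value n K ori bs)"
proof -
  have len: "length (SOME vs. vs \<in> ori \<sigma>) = n" if "\<sigma> \<in> simplices (n - 1) K" for \<sigma>
  proof -
    have "simplex_orientation \<sigma> (ori \<sigma>)" using co that by (auto simp: consistent_orientation_def)
    hence "set (SOME vs. vs \<in> ori \<sigma>) = \<sigma>" "distinct (SOME vs. vs \<in> ori \<sigma>)"
      using simplex_orientation_some by blast+
    hence "length (SOME vs. vs \<in> ori \<sigma>) = card \<sigma>" using distinct_card by metis
    thus ?thesis using that n by (simp add: simplices_def)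
  qed
  have det: "polynomial_in i (\<lambda>y. det_of_list n (\<lambda>v. vertex_position n y (Some v) - vertex_position n y None) vs)"
    if "length vs = n" for vs
  proof -
    have "det_of_list n (\<lambda>v. vertex_position n y (Some v) - vertex_position n y None) vs =
       det (mat n n (\<lambda>(a, b). y (Some (vs ! b), a) - y (None, a)))" for y
      unfolding det_of_list_def
      by (rule arg_cong[of _ _ det], rule eq_matI) (use that in \<open>auto simp: mat_of_cols_index vertex_position_def\<close>)
    moreover have "polynomial_in i (\<lambda>y. det (mat n n (\<lambda>(a, b). y (Some (vs ! b), a) - y (None, a))))"
      by (intro polynomial_in_det polynomial_in_diff polynomial_in_coordinate)
    ultimately show ?thesis by simp
  qed
  have W: "polynomial_in i (weighted_volume n K ori)"
    unfolding weighted_volume_def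
    by (intro polynomial_in_mult polynomial_in_const polynomial_in_sum det len)
  have l: "polynomial_in i (\<lambda>y. square_length n y e)" for e :: "'a set"
  proof -
    have "polynomial_in i (\<lambda>y. (\<Sum>a\<in>e. \<Sum>b\<in>e. \<Sum>j<n. (y (Some a, j) - y (Some b, j))\<^sup>2) * (1 / 2))"
      by (intro polynomial_in_mult polynomial_in_sum polynomial_in_power polynomial_in_diff
          polynomial_in_coordinate polynomial_in_const)
    thus ?thesis by (simp add: square_length_def)
  qed
  have "polynomial_in i (\<lambda>y. eval_mpoly (square_length n y) p)" for p :: "'a set int_mpoly"
    unfolding eval_mpoly_def
    by (intro polynomial_in_mult polynomial_in_sum polynomial_in_prod polynomial_in_power polynomial_in_const l)
  thus ?thesis
    unfolding relation_value_def
    by (intro polynomial_in_add polynomial_in_mult polynomial_in_sum polynomial_in_power W)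
qed

lemma relation_value_cong:
  assumes co: "consistent_orientation (n - 1) K ori" and bs: "set bs \<subseteq> polys_over (edges K)"
    and y: "\<And>i. i < n \<Longrightarrow> y (None, i) = y' (None, i)"
      "\<And>v i. v \<in> \<Union>K \<Longrightarrow> i < n \<Longrightarrow> y (Some v, i) = y' (Some v, i)"
  shows "relation_value n K ori bs y = relation_value n K ori bs y'"
proof -
  have p: "vertex_position n y None = vertex_position n y' None"
    "vertex_position n y (Some v) = vertex_position n y' (Some v)" if "v \<in> \<Union>K" for v
    using y(1) y(2)[OF that] by (auto simp: vertex_position_def intro!: eq_vecI simp del: Union_iff)
  have W: "weighted_volume n K ori y = weighted_volume n K ori y'"
    unfolding weighted_volume_def det_of_list_def
  proof (intro arg_cong2[where f="(*)"] refl sum.cong arg_cong[of _ _ det] arg_cong[of _ _ "mat_of_cols n"] map_cong)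
    fix \<sigma> v assume \<sigma>: "\<sigma> \<in> simplices (n - 1) K" and v: "v \<in> set (SOME vs. vs \<in> ori \<sigma>)"
    have "simplex_orientation \<sigma> (ori \<sigma>)" using co \<sigma> by (auto simp: consistent_orientation_def)
    hence "v \<in> \<sigma>" using simplex_orientation_some v by blast
    hence "v \<in> \<Union>K" using \<sigma> by (auto simp: simplices_def)
    thus "vertex_position n y (Some v) - vertex_position n y None =
        vertex_position n y' (Some v) - vertex_position n y' None" using p by simp
  qed
  have l: "square_length n y e = square_length n y' e" if "e \<in> edges K" for e
    unfolding square_length_def
  proof (intro arg_cong[of _ _ "\<lambda>t. t / 2"] sum.cong refl)
    fix a b i assume "a \<in> e" "b \<in> e" "i \<in> {..<n}"
    moreover have "e \<in> K" using that by (simp add: edges_def simplices_def)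
    ultimately show "(y (Some a, i) - y (Some b, i))\<^sup>2 = (y' (Some a, i) - y' (Some b, i))\<^sup>2"
      using y(2)[of a i] y(2)[of b i] by (metis UnionI lessThan_iff)
  qed
  have "eval_mpoly (square_length n y) (bs ! (i - 1)) = eval_mpoly (square_length n y') (bs ! (i - 1))"
    if "i \<in> {1..length bs}" for i
    by (rule eval_mpoly_cong[of _ "edges K"]) (use that bs l in auto)
  thus ?thesis unfolding relation_value_def W by simp
qed

text \<open>The candidates are the countably many lists of polynomials over the finitely many edges. Every configuration
of points satisfies one of them, so it cannot be that each of them fails somewhere.\<close>

lemma universal_relation:
  assumes n: "n \<ge> 3" and K: "finite K" and pm: "pseudo_manifold (n - 1) K"
    and co: "consistent_orientation (n - 1) K ori"
  shows "\<exists>bs. bs \<noteq> [] \<and> set bs \<subseteq> polys_over (edges K) \<and> (\<forall>y. relation_value n K ori bs y = 0)"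
proof (rule ccontr)
  assume none: "\<not> ?thesis"
  have sc: "simplicial_complex K" using pm by (simp add: pseudo_manifold_def)
  define B where "B = {bs. bs \<noteq> [] \<and> set bs \<subseteq> polys_over (edges K)}"
  define I where "I = (insert None (Some ` \<Union>K)) \<times> {..<n}"
  have "finite I" using finite_vertices[OF K sc] by (simp add: I_def)
  have "countable (edges K)" using K by (intro countable_finite) (simp add: edges_def simplices_def)
  hence "countable (lists (polys_over (edges K)))" by (intro countable_lists countable_polys_over)
  hence "countable B" by (rule countable_subset[rotated]) (auto simp: B_def)
  hence "countable (relation_value n K ori ` B)" by (rule countable_image)
  have "\<exists>y. \<forall>F\<in>relation_value n K ori ` B. \<exists>x. F (\<lambda>i. if i \<in> I then y i else x i) \<noteq> 0"
  proof (rule common_nonzero[OF \<open>finite I\<close> \<open>countable (relation_value n K ori ` B)\<close>])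
    show "polynomial_in i F" if "F \<in> relation_value n K ori ` B" for F i
    proof -
      from that obtain bs where F: "F = relation_value n K ori bs" by blast
      show ?thesis unfolding F by (rule polynomial_in_relation_value[OF _ co]) (use n in simp)
    qed
    show "\<exists>x. F x \<noteq> 0" if "F \<in> relation_value n K ori ` B" for F
      using none that unfolding B_def by blast
  qed
  then obtain y where
    y: "\<forall>F\<in>relation_value n K ori ` B. \<exists>x. F (\<lambda>i. if i \<in> I then y i else x i) \<noteq> 0" by blast
  obtain bs where bs: "bs \<noteq> []" "set bs \<subseteq> polys_over (edges K)" "relation_value n K ori bs y = 0"
    using relation_at_each_polyhedron[OF n K pm co] by blast
  then obtain x where x: "relation_value n K ori bs (\<lambda>i. if i \<in> I then y i else x i) \<noteq> 0"
    using y unfolding B_def by blast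
  have "relation_value n K ori bs (\<lambda>i. if i \<in> I then y i else x i) = relation_value n K ori bs y"
    by (rule relation_value_cong[OF co bs(2)]) (auto simp: I_def)
  thus False using x bs(3) by simp
qed

theorem theorem1p3:
  fixes n :: nat and K :: "'v set set" and ori :: "'v set \<Rightarrow> 'v list set"
  assumes "n \<ge> 3"
    and "finite K"
    and "pseudo_manifold (n - 1) K"
    and "strongly_connected (n - 1) K"
    and "consistent_orientation (n - 1) K ori"
  shows "\<exists>N\<ge>1. \<exists>b :: nat \<Rightarrow> 'v set int_mpoly.
           (\<forall>i\<in>{1..N}. b i \<in> polys_over (edges K)) \<and>
           (\<forall>P Q l W. simplicial_polyhedron n K P \<longrightarrow> Q \<in> carrier_vec n \<longrightarrow>
              squared_edge_lengths K P l \<longrightarrow>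
              W = 2 ^ (n div 2) * fact n * generalized_volume n K ori Q P \<longrightarrow>
              W ^ (2 * N) + (\<Sum>i = 1..N. eval_mpoly l (b i) * W ^ (2 * N - 2 * i)) = 0)"
proof -
  obtain bs where bs: "bs \<noteq> []" "set bs \<subseteq> polys_over (edges K)" "\<And>y. relation_value n K ori bs y = 0"
    using universal_relation[OF assms(1-3,5)] by blast
  have sc: "simplicial_complex K" using assms(3) by (simp add: pseudo_manifold_def)
  define b where "b = (\<lambda>i. bs ! (i - 1))"
  have b: "b i \<in> polys_over (edges K)" if "i \<in> {1..length bs}" for i
    using that bs(2) by (auto simp: b_def)
  have "W ^ (2 * length bs) + (\<Sum>i = 1..length bs. eval_mpoly l (b i) * W ^ (2 * length bs - 2 * i)) = 0"
    if P: "simplicial_polyhedron n K P" and Q: "Q \<in> carrier_vec n" and l: "squared_edge_lengths K P l"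
      and W: "W = 2 ^ (n div 2) * fact n * generalized_volume n K ori Q P" for P Q l W
  proof -
    define y where "y = (\<lambda>(w, i). case w of None \<Rightarrow> Q $ i | Some v \<Rightarrow> P (vertex_point v) $ i)"
    have carr: "P (vertex_point v) \<in> carrier_vec n" if "v \<in> \<Union>K" for v
    proof -
      have "{v} \<in> K" using that sc unfolding simplicial_complex_def by blast
      moreover have "{w. vertex_point v w \<noteq> 0} = {v}" by (auto simp: vertex_point_def)
      ultimately have "vertex_point v \<in> geometric_realization K"
        by (simp add: geometric_realization_def) (simp add: vertex_point_def)
      thus ?thesis using P by (simp add: simplicial_polyhedron_def)
    qed
    have posQ: "vertex_position n y None = Q"
      using Q by (intro eq_vecI) (auto simp: vertex_position_def y_def)
    have pos: "vertex_position n y (Some v) = P (vertex_point v)" if "v \<in> \<Union>K" for v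
      using carr[OF that] by (intro eq_vecI) (auto simp: vertex_position_def y_def)
    have "(\<Sum>\<sigma>\<in>simplices (n - 1) K. det_of_list n (\<lambda>v. vertex_position n y (Some v) - vertex_position n y None)
          (SOME vs. vs \<in> ori \<sigma>)) =
        (\<Sum>\<sigma>\<in>simplices (n - 1) K. det (mat_of_cols n (map (\<lambda>p. p - Q)
          (map (\<lambda>v. P (vertex_point v)) (SOME vs. vs \<in> ori \<sigma>)))))"
      unfolding det_of_list_def map_map
    proof (intro sum.cong refl arg_cong[of _ _ det] arg_cong[of _ _ "mat_of_cols n"] map_cong)
      fix \<sigma> v assume \<sigma>: "\<sigma> \<in> simplices (n - 1) K" and v: "v \<in> set (SOME vs. vs \<in> ori \<sigma>)"
      have "simplex_orientation \<sigma> (ori \<sigma>)" using assms(5) \<sigma> by (auto simp: consistent_orientation_def)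
      hence "v \<in> \<sigma>" using simplex_orientation_some v by blast
      hence "v \<in> \<Union>K" using \<sigma> by (auto simp: simplices_def)
      thus "vertex_position n y (Some v) - vertex_position n y None = ((\<lambda>p. p - Q) \<circ> (\<lambda>v. P (vertex_point v))) v"
        using pos posQ by simp
    qed
    hence "weighted_volume n K ori y = W"
      unfolding W weighted_volume_def generalized_volume_def oriented_simplex_volume_def
      by (simp add: sum_divide_distrib[symmetric])
    moreover have "eval_mpoly (square_length n y) (bs ! (i - 1)) = eval_mpoly l (b i)"
      if "i \<in> {1..length bs}" for i
    proof -
      have "b i = bs ! (i - 1)" by (simp add: b_def)
      moreover have "eval_mpoly (square_length n y) (b i) = eval_mpoly l (b i)"
      proof (rule eval_mpoly_cong[OF b[OF that]])
        fix e assume e: "e \<in> edges K"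
        hence "card e = 2" "e \<in> K" by (auto simp: edges_def simplices_def)
        then obtain u v where uv: "e = {u, v}" "u \<noteq> v" by (auto simp: card_2_iff)
        have mem: "u \<in> \<Union>K" "v \<in> \<Union>K" using uv \<open>e \<in> K\<close> by auto
        have "square_length n y e = (\<Sum>i<n. (P (vertex_point u) $ i - P (vertex_point v) $ i)\<^sup>2)"
          unfolding uv(1) square_length_edge[OF uv(2)] by (simp add: y_def)
        also have "\<dots> = (P (vertex_point u) - P (vertex_point v)) \<bullet> (P (vertex_point u) - P (vertex_point v))"
          using carr[OF mem(1)] carr[OF mem(2)] by (simp add: scalar_prod_def power2_eq_square atLeast0LessThan)
        also have "\<dots> = l e" using l e unfolding squared_edge_lengths_def uv(1) by simp
        finally show "square_length n y e = l e" .
      qed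
      ultimately show ?thesis by simp
    qed
    ultimately show ?thesis using bs(3)[of y] unfolding relation_value_def by simp
  qed
  moreover have "1 \<le> length bs" using bs(1) by (cases bs) auto
  ultimately show ?thesis using b by (intro exI[of _ "length bs"] conjI exI[of _ b]) blast+
qed

end
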